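(* Let $M\subset H^2(\mathbb{D}^2)$ be a minimal invariant subspace for $T_z^*$. Then for every $g\in H^2(w)$ there exists a $t_z^*$-invariant subspace $V\subset H^2(\mathbb{D})$ such that either $P_g(M)=\{0\}$ or $\overline{P_g(M)}=V$.
   Context: $H^2(\mathbb{D}^2)$ is the Hardy space over the bidisk $\mathbb{D}^2$ with variables $(z,w)$; $H^2(z)$ and $H^2(w)$ are the classical Hardy spaces over $\mathbb{D}$ in the variable $z$, respectively $w$, and $H^2(z)$ is identified with $H^2(\mathbb{D})$. $T_z$ is multiplication by $z$ on $H^2(\mathbb{D}^2)$ and $T_z^*$ its adjoint; $t_z$ is multiplication by $z$ on $H^2(\mathbb{D})$ and $t_z^*$ its adjoint (the backward shift). An invariant subspace of an operator $T$ is a closed subspace $E$ with $TE\subset E$ (also called a $T$-invariant subspace); a minimal invariant subspace is a nonzero invariant subspace that contains no invariant subspaces other than $\{0\}$ and itself. For $g\in H^2(w)$, the operator $P_g:H^2(\mathbb{D}^2)\to H^2(z)$ is defined by $P_g(f)(z)=\int_{\mathbb{T}}f(z,w)\overline{g(w)}\,dw$, where $dw$ is normalized Lebesgue measure on the unit circle $\mathbb{T}$ (i.e. the inner product of $f(z,\cdot)$ and $g$ in the variable $w$). Closures are taken in norm. *)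

theory Defs
  imports "HOL-Complex_Analysis.Complex_Analysis" "HOL-Library.Function_Algebras"
begin

text \<open>
  A Hilbert space of functions is given by its carrier \<open>H\<close> and an inner product \<open>ip\<close>, linear in the
  first argument. The values of \<open>ip\<close> matter only on \<open>H\<close>. Vector space operations and \<open>0\<close> are pointwise.
\<close>

definition fscale :: "complex \<Rightarrow> ('a \<Rightarrow> complex) \<Rightarrow> 'a \<Rightarrow> complex" where
  "fscale c f = (\<lambda>x. c * f x)"

global_interpretation cfun: vector_space "fscale :: complex \<Rightarrow> ('a \<Rightarrow> complex) \<Rightarrow> 'a \<Rightarrow> complex"
  by unfold_locales (auto simp: fscale_def fun_eq_iff algebra_simps)

definition ip_norm :: "(('a \<Rightarrow> complex) \<Rightarrow> ('a \<Rightarrow> complex) \<Rightarrow> complex) \<Rightarrow> ('a \<Rightarrow> complex) \<Rightarrow> real" where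
  "ip_norm ip f = sqrt (Re (ip f f))"

definition norm_closure ::
  "('a \<Rightarrow> complex) set \<Rightarrow> (('a \<Rightarrow> complex) \<Rightarrow> ('a \<Rightarrow> complex) \<Rightarrow> complex)
     \<Rightarrow> ('a \<Rightarrow> complex) set \<Rightarrow> ('a \<Rightarrow> complex) set" where
  "norm_closure H ip S = {f \<in> H. \<forall>e>0. \<exists>g\<in>S. ip_norm ip (f - g) < e}"

definition closed_subspace ::
  "('a \<Rightarrow> complex) set \<Rightarrow> (('a \<Rightarrow> complex) \<Rightarrow> ('a \<Rightarrow> complex) \<Rightarrow> complex)
     \<Rightarrow> ('a \<Rightarrow> complex) set \<Rightarrow> bool" where
  "closed_subspace H ip E \<longleftrightarrow> E \<subseteq> H \<and> cfun.subspace E \<and> norm_closure H ip E = E"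

definition adjoint_on ::
  "('a \<Rightarrow> complex) set \<Rightarrow> (('a \<Rightarrow> complex) \<Rightarrow> ('a \<Rightarrow> complex) \<Rightarrow> complex)
     \<Rightarrow> (('a \<Rightarrow> complex) \<Rightarrow> 'a \<Rightarrow> complex) \<Rightarrow> ('a \<Rightarrow> complex) \<Rightarrow> 'a \<Rightarrow> complex" where
  "adjoint_on H ip T f = (THE h. h \<in> H \<and> (\<forall>k\<in>H. ip h k = ip f (T k)))"

definition invariant_subspace ::
  "('a \<Rightarrow> complex) set \<Rightarrow> (('a \<Rightarrow> complex) \<Rightarrow> ('a \<Rightarrow> complex) \<Rightarrow> complex)
     \<Rightarrow> (('a \<Rightarrow> complex) \<Rightarrow> 'a \<Rightarrow> complex) \<Rightarrow> ('a \<Rightarrow> complex) set \<Rightarrow> bool" where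
  "invariant_subspace H ip T E \<longleftrightarrow> closed_subspace H ip E \<and> T ` E \<subseteq> E"

definition minimal_invariant_subspace ::
  "('a \<Rightarrow> complex) set \<Rightarrow> (('a \<Rightarrow> complex) \<Rightarrow> ('a \<Rightarrow> complex) \<Rightarrow> complex)
     \<Rightarrow> (('a \<Rightarrow> complex) \<Rightarrow> 'a \<Rightarrow> complex) \<Rightarrow> ('a \<Rightarrow> complex) set \<Rightarrow> bool" where
  "minimal_invariant_subspace H ip T E \<longleftrightarrow>
     invariant_subspace H ip T E \<and> E \<noteq> {0} \<and>
     (\<forall>F. invariant_subspace H ip T F \<and> F \<subseteq> E \<longrightarrow> F = {0} \<or> F = E)"

abbreviation unit_disk :: "complex set" ("\<bbbD>") where
  "\<bbbD> \<equiv> ball 0 1"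

text \<open>The integral over the unit circle with respect to normalized Lebesgue measure.\<close>

definition circle_integral :: "(complex \<Rightarrow> complex) \<Rightarrow> complex" where
  "circle_integral F = integral {0..2 * pi} (\<lambda>t. F (cis t)) / of_real (2 * pi)"

text \<open>
  Elements of the Hardy spaces are holomorphic functions on the open disk or bidisk; they are
  represented by total functions that are \<open>0\<close> elsewhere, so that equality in the Hardy space is
  equality of HOL functions.
\<close>

definition hardy :: "(complex \<Rightarrow> complex) set" where
  "hardy = {f. f holomorphic_on \<bbbD> \<and> (\<forall>z. z \<notin> \<bbbD> \<longrightarrow> f z = 0) \<and>
     bdd_above ((\<lambda>r. Re (circle_integral (\<lambda>z. of_real ((cmod (f (of_real r * z)))\<^sup>2)))) ` {0<..<1})}"

text \<open>
  For \<open>f\<close>, \<open>g\<close> in the Hardy space the limit exists and is the integral over the unit circle of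
  \<open>f\<close> times the conjugate of \<open>g\<close>, formed with the \<open>L\<^sup>2\<close> boundary values of \<open>f\<close> and \<open>g\<close>.
\<close>

definition hardy_inner :: "(complex \<Rightarrow> complex) \<Rightarrow> (complex \<Rightarrow> complex) \<Rightarrow> complex" where
  "hardy_inner f g =
     Lim (at_left (1 :: real))
       (\<lambda>r. circle_integral (\<lambda>z. f (of_real r * z) * cnj (g (of_real r * z))))"

text \<open>By Osgood's lemma this is the same as complex differentiability in two variables.\<close>

definition holomorphic_on_bidisk :: "(complex \<times> complex \<Rightarrow> complex) \<Rightarrow> bool" where
  "holomorphic_on_bidisk f \<longleftrightarrow>
     continuous_on (\<bbbD> \<times> \<bbbD>) f \<and>
     (\<forall>w\<in>\<bbbD>. (\<lambda>z. f (z, w)) holomorphic_on \<bbbD>) \<and>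
     (\<forall>z\<in>\<bbbD>. (\<lambda>w. f (z, w)) holomorphic_on \<bbbD>)"

definition hardy2 :: "(complex \<times> complex \<Rightarrow> complex) set" where
  "hardy2 = {f. holomorphic_on_bidisk f \<and> (\<forall>p. p \<notin> \<bbbD> \<times> \<bbbD> \<longrightarrow> f p = 0) \<and>
     bdd_above ((\<lambda>r. Re (circle_integral (\<lambda>z. circle_integral (\<lambda>w.
       of_real ((cmod (f (of_real r * z, of_real r * w)))\<^sup>2))))) ` {0<..<1})}"

definition hardy2_inner ::
  "(complex \<times> complex \<Rightarrow> complex) \<Rightarrow> (complex \<times> complex \<Rightarrow> complex) \<Rightarrow> complex" where
  "hardy2_inner f g =
     Lim (at_left (1 :: real))
       (\<lambda>r. circle_integral (\<lambda>z. circle_integral (\<lambda>w.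
          f (of_real r * z, of_real r * w) * cnj (g (of_real r * z, of_real r * w)))))"

definition shift :: "(complex \<Rightarrow> complex) \<Rightarrow> complex \<Rightarrow> complex" where
  "shift f = (\<lambda>z. z * f z)"

definition shift_z :: "(complex \<times> complex \<Rightarrow> complex) \<Rightarrow> complex \<times> complex \<Rightarrow> complex" where
  "shift_z f = (\<lambda>(z, w). z * f (z, w))"

definition shift_adj :: "(complex \<Rightarrow> complex) \<Rightarrow> complex \<Rightarrow> complex" where
  "shift_adj = adjoint_on hardy hardy_inner shift"

definition shift_z_adj :: "(complex \<times> complex \<Rightarrow> complex) \<Rightarrow> complex \<times> complex \<Rightarrow> complex" where
  "shift_z_adj = adjoint_on hardy2 hardy2_inner shift_z"

text \<open>
  The circle integral of \<open>f(z, w)\<close> times the conjugate of \<open>g(w)\<close> over \<open>w\<close>, where \<open>f(z, \<cdot>)\<close> and \<open>g\<close>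
  enter through their boundary values: the inner product of \<open>f(z, \<cdot>)\<close> and \<open>g\<close>.
\<close>

definition P_g :: "(complex \<Rightarrow> complex) \<Rightarrow> (complex \<times> complex \<Rightarrow> complex) \<Rightarrow> complex \<Rightarrow> complex" where
  "P_g g f = (\<lambda>z. hardy_inner (\<lambda>w. f (z, w)) g)"

end

theory Submission
  imports Defs
begin

text \<open>
  In terms of Taylor coefficients, both Hardy spaces are spaces of square summable families and the
  adjoint of multiplication by \<open>z\<close> deletes the terms of degree \<open>0\<close> in \<open>z\<close> and shifts down the others. If
  \<open>g\<close> has coefficients \<open>b\<^sub>n\<close>, then \<open>P_g\<close> maps \<open>(a\<^sub>m\<^sub>n)\<close> to the sequence with \<open>m\<close>-th term
  \<open>\<Sum>\<^sub>n a\<^sub>m\<^sub>n cnj b\<^sub>n\<close>, square summable by Cauchy-Schwarz. It acts on the index \<open>n\<close> only, so it intertwines the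
  two backward shifts. Hence \<open>P_g(M)\<close> is a linear subspace that is mapped into itself by the backward shift,
  and as the backward shift is a contraction, so is the closure.
\<close>

subsection \<open>Square summable families\<close>

text \<open>The obstacle is the distance between the definitions and the coefficients. A Hardy norm
  is a bound on integral means over radii r < 1, an inner product is a \<open>Lim\<close> as r tends
  to 1, and an adjoint is selected by \<open>THE\<close>, so limits must be shown to exist and
  candidates to be unique. Parseval's formula at radius r is the bridge: it turns the means into
  sums of \<open>a i * cnj (b i) * r ^ (2 * deg i)\<close>, and passing to r = 1 becomes a question
  about series. On the bidisk a function is only given as continuous and separately holomorphic, so
  its double power series has to be constructed before Parseval's formula applies. Sums are
  unconditional and run over an arbitrary index type. Thus families over \<open>nat\<close> and over
  \<open>nat \<times> nat\<close> share one theory, and exchanging the two indices, which is what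
  computing \<open>P_g\<close> amounts to, is a matter of absolute convergence alone.\<close>

definition ell2 :: "('i \<Rightarrow> complex) \<Rightarrow> bool" where
  "ell2 a \<longleftrightarrow> (\<lambda>i. (cmod (a i))\<^sup>2) summable_on UNIV"

lemma ell2_mult_summable:
  assumes "ell2 a" "ell2 b"
  shows "(\<lambda>i. a i * b i) summable_on UNIV"
proof -
  have "(\<lambda>i. (cmod (a i))\<^sup>2 + (cmod (b i))\<^sup>2) summable_on UNIV"
    using assms by (auto simp: ell2_def intro: summable_on_add)
  moreover have "norm (a i * b i) \<le> (cmod (a i))\<^sup>2 + (cmod (b i))\<^sup>2" for i
    using sum_squares_bound[of "cmod (a i)" "cmod (b i)"]
      mult_nonneg_nonneg[OF norm_ge_zero[of "a i"] norm_ge_zero[of "b i"]]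
    unfolding norm_mult by linarith
  ultimately have "(\<lambda>i. norm (a i * b i)) summable_on UNIV"
    by (rule Infinite_Sum.abs_summable_on_comparison_test')
  then show ?thesis by (rule abs_summable_summable)
qed

lemma ell2_cnj_iff [simp]: "ell2 (\<lambda>i. cnj (a i)) \<longleftrightarrow> ell2 a"
  by (simp add: ell2_def)

lemma ell2_mult_cnj_summable: "ell2 a \<Longrightarrow> ell2 b \<Longrightarrow> (\<lambda>i. a i * cnj (b i)) summable_on UNIV"
  using ell2_mult_summable[of a "\<lambda>i. cnj (b i)"] by simp

lemma ell2_0 [simp]: "ell2 (\<lambda>_. 0)"
  by (simp add: ell2_def)

lemma ell2_scale: "ell2 a \<Longrightarrow> ell2 (\<lambda>i. c * a i)"
  by (simp add: ell2_def norm_mult power_mult_distrib summable_on_cmult_right)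

lemma L2_set_le_ell2:
  assumes "ell2 a" "finite F"
  shows "L2_set (\<lambda>i. cmod (a i)) F \<le> sqrt (\<Sum>\<^sub>\<infinity>i. (cmod (a i))\<^sup>2)"
  using assms unfolding L2_set_def ell2_def
  by (auto intro!: real_sqrt_le_mono finite_sum_le_infsum)

lemma L2_set_add_le_ell2:
  assumes "ell2 a" "ell2 b" "finite F"
  shows "L2_set (\<lambda>i. cmod (a i + b i)) F \<le>
    sqrt (\<Sum>\<^sub>\<infinity>i. (cmod (a i))\<^sup>2) + sqrt (\<Sum>\<^sub>\<infinity>i. (cmod (b i))\<^sup>2)"
proof -
  have "L2_set (\<lambda>i. cmod (a i + b i)) F \<le> L2_set (\<lambda>i. cmod (a i) + cmod (b i)) F"
    by (rule L2_set_mono) (auto intro: norm_triangle_ineq)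
  also have "\<dots> \<le> L2_set (\<lambda>i. cmod (a i)) F + L2_set (\<lambda>i. cmod (b i)) F"
    by (rule L2_set_triangle_ineq)
  finally show ?thesis
    using L2_set_le_ell2[of a F] L2_set_le_ell2[of b F] assms by linarith
qed

text \<open>Estimates that are uniform in \<open>F\<close> survive the passage to the whole index
  set. Applied to Minkowski's inequality for finite sums, this gives closure under addition together
  with the triangle inequality.\<close>

lemma ell2_if_L2_set_le:
  assumes "\<And>F. finite F \<Longrightarrow> L2_set (\<lambda>i. cmod (a i)) F \<le> B"
  shows "ell2 a" "sqrt (\<Sum>\<^sub>\<infinity>i. (cmod (a i))\<^sup>2) \<le> B"
proof -
  have B: "0 \<le> B" using assms[of "{}"] by simp
  have le: "(\<Sum>i\<in>F. (cmod (a i))\<^sup>2) \<le> B\<^sup>2" if "finite F" for F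
    using assms[OF that] unfolding L2_set_def by (rule sqrt_le_D)
  show *: "ell2 a" unfolding ell2_def
    by (rule nonneg_bdd_above_summable_on) (auto intro!: bdd_aboveI[of _ "B\<^sup>2"] le)
  have "(\<Sum>\<^sub>\<infinity>i. (cmod (a i))\<^sup>2) \<le> B\<^sup>2"
    using * unfolding ell2_def by (rule infsum_le_finite_sums) (auto intro: le)
  then show "sqrt (\<Sum>\<^sub>\<infinity>i. (cmod (a i))\<^sup>2) \<le> B"
    using B by (rule real_le_lsqrt[rotated])
qed

lemma
  assumes "ell2 a" "ell2 b"
  shows ell2_add: "ell2 (\<lambda>i. a i + b i)"
    and ell2_triangle: "sqrt (\<Sum>\<^sub>\<infinity>i. (cmod (a i + b i))\<^sup>2) \<le>
      sqrt (\<Sum>\<^sub>\<infinity>i. (cmod (a i))\<^sup>2) + sqrt (\<Sum>\<^sub>\<infinity>i. (cmod (b i))\<^sup>2)"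
  using ell2_if_L2_set_le[OF L2_set_add_le_ell2[OF assms]] by auto

lemma ell2_diff: "ell2 a \<Longrightarrow> ell2 b \<Longrightarrow> ell2 (\<lambda>i. a i - b i)"
  using ell2_add[of a "\<lambda>i. - 1 * b i"] ell2_scale[of b "-1"] by simp

lemma ell2_Cauchy_Schwarz:
  assumes "ell2 a" "ell2 b"
  shows "cmod (\<Sum>\<^sub>\<infinity>i. a i * b i) \<le>
    sqrt (\<Sum>\<^sub>\<infinity>i. (cmod (a i))\<^sup>2) * sqrt (\<Sum>\<^sub>\<infinity>i. (cmod (b i))\<^sup>2)"
proof (rule tendsto_upperbound)
  show "((\<lambda>F. cmod (\<Sum>i\<in>F. a i * b i)) \<longlongrightarrow> cmod (\<Sum>\<^sub>\<infinity>i. a i * b i)) (finite_subsets_at_top UNIV)"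
    by (intro tendsto_norm infsum_tendsto ell2_mult_summable assms)
  have "cmod (\<Sum>i\<in>F. a i * b i) \<le>
    sqrt (\<Sum>\<^sub>\<infinity>i. (cmod (a i))\<^sup>2) * sqrt (\<Sum>\<^sub>\<infinity>i. (cmod (b i))\<^sup>2)" if "finite F" for F
  proof -
    have "cmod (\<Sum>i\<in>F. a i * b i) \<le> (\<Sum>i\<in>F. \<bar>cmod (a i)\<bar> * \<bar>cmod (b i)\<bar>)"
      by (rule order_trans[OF norm_sum]) (simp add: norm_mult)
    also have "\<dots> \<le> L2_set (\<lambda>i. cmod (a i)) F * L2_set (\<lambda>i. cmod (b i)) F"
      by (rule L2_set_mult_ineq)
    also have "\<dots> \<le> sqrt (\<Sum>\<^sub>\<infinity>i. (cmod (a i))\<^sup>2) * sqrt (\<Sum>\<^sub>\<infinity>i. (cmod (b i))\<^sup>2)"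
      by (intro mult_mono L2_set_le_ell2 assms that)
        (auto intro!: infsum_nonneg simp: L2_set_nonneg)
    finally show ?thesis .
  qed
  then show "\<forall>\<^sub>F F in finite_subsets_at_top UNIV. cmod (\<Sum>i\<in>F. a i * b i) \<le>
    sqrt (\<Sum>\<^sub>\<infinity>i. (cmod (a i))\<^sup>2) * sqrt (\<Sum>\<^sub>\<infinity>i. (cmod (b i))\<^sup>2)"
    by (intro eventually_finite_subsets_at_top_weakI) auto
qed simp

text \<open>Composition with an injection keeps a subfamily of the squares. For \<open>Suc\<close>
  this is the contraction property of the backward shift.\<close>

lemma
  assumes "inj \<sigma>" "ell2 a"
  shows ell2_comp_inj: "ell2 (a \<circ> \<sigma>)"
    and ell2_comp_inj_le: "(\<Sum>\<^sub>\<infinity>i. (cmod ((a \<circ> \<sigma>) i))\<^sup>2) \<le> (\<Sum>\<^sub>\<infinity>i. (cmod (a i))\<^sup>2)"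
proof -
  have s: "(\<lambda>i. (cmod (a i))\<^sup>2) summable_on range \<sigma>"
    using assms(2) unfolding ell2_def by (rule summable_on_subset) auto
  then show "ell2 (a \<circ> \<sigma>)"
    using assms(1) by (simp add: summable_on_reindex ell2_def o_def)
  have "(\<Sum>\<^sub>\<infinity>i. (cmod ((a \<circ> \<sigma>) i))\<^sup>2) = (\<Sum>\<^sub>\<infinity>i\<in>range \<sigma>. (cmod (a i))\<^sup>2)"
    using assms(1) by (simp add: infsum_reindex o_def)
  also have "\<dots> \<le> (\<Sum>\<^sub>\<infinity>i. (cmod (a i))\<^sup>2)"
    using s assms(2) unfolding ell2_def by (intro infsum_mono2) auto
  finally show "(\<Sum>\<^sub>\<infinity>i. (cmod ((a \<circ> \<sigma>) i))\<^sup>2) \<le> (\<Sum>\<^sub>\<infinity>i. (cmod (a i))\<^sup>2)" .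
qed

section \<open>Double sums over product index sets\<close>

lemma
  fixes a :: "'i \<Rightarrow> complex" and b :: "'j \<Rightarrow> complex"
  assumes "a summable_on UNIV" "b summable_on UNIV"
  shows summable_on_product: "(\<lambda>k. a (fst k) * b (snd k)) summable_on UNIV"
    and infsum_product: "(\<Sum>\<^sub>\<infinity>k. a (fst k) * b (snd k)) = (\<Sum>\<^sub>\<infinity>i. a i) * (\<Sum>\<^sub>\<infinity>j. b j)"
proof -
  \<comment> \<open>Over the complex numbers summable means absolutely summable, so the moduli can
    be summed row by row.\<close>
  have a: "(\<lambda>i. cmod (a i)) summable_on UNIV" and b: "(\<lambda>i. cmod (b i)) summable_on UNIV"
    using assms by (simp_all add: summable_on_iff_abs_summable_on_complex)
  have "(\<lambda>k. norm (a (fst k) * b (snd k))) summable_on UNIV \<times> UNIV"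
    by (rule summable_on_SigmaI[where g = "\<lambda>i. cmod (a i) * (\<Sum>\<^sub>\<infinity>j. cmod (b j))"])
      (use a b in \<open>auto simp: norm_mult intro!: has_sum_cmult_right has_sum_infsum summable_on_cmult_left\<close>)
  then show *: "(\<lambda>k. a (fst k) * b (snd k)) summable_on UNIV"
    by (simp add: abs_summable_summable)
  have "(\<Sum>\<^sub>\<infinity>k. a (fst k) * b (snd k)) = (\<Sum>\<^sub>\<infinity>i. \<Sum>\<^sub>\<infinity>j. a i * b j)"
    using infsum_Sigma_banach[of "\<lambda>k. a (fst k) * b (snd k)" UNIV "\<lambda>_. UNIV"] * by simp
  also have "\<dots> = (\<Sum>\<^sub>\<infinity>i. a i) * (\<Sum>\<^sub>\<infinity>j. b j)"
    by (simp add: infsum_cmult_left' infsum_cmult_right')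
  finally show "(\<Sum>\<^sub>\<infinity>k. a (fst k) * b (snd k)) = (\<Sum>\<^sub>\<infinity>i. a i) * (\<Sum>\<^sub>\<infinity>j. b j)" .
qed

text \<open>Orthogonality of the monomials on the distinguished boundary leaves a double sum
  supported on the diagonal; this makes it a single sum.\<close>

lemma infsum_diagonal:
  fixes c :: "'i \<times> 'i \<Rightarrow> complex"
  shows "(\<Sum>\<^sub>\<infinity>k. if fst k = snd k then c k else 0) = (\<Sum>\<^sub>\<infinity>i. c (i, i))"
proof -
  have "(\<Sum>\<^sub>\<infinity>k. if fst k = snd k then c k else 0) = (\<Sum>\<^sub>\<infinity>k\<in>range (\<lambda>i. (i, i)). c k)"
    by (rule infsum_cong_neutral) (auto split: if_splits)
  also have "\<dots> = (\<Sum>\<^sub>\<infinity>i. c (i, i))"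
    by (subst infsum_reindex) (auto simp: inj_on_def o_def)
  finally show ?thesis .
qed

lemma infsum_complex_of_real:
  "f summable_on A \<Longrightarrow> (\<Sum>\<^sub>\<infinity>i\<in>A. complex_of_real (f i)) = of_real (\<Sum>\<^sub>\<infinity>i\<in>A. f i)"
  by (intro infsumI has_sum_of_real has_sum_infsum)

subsection \<open>Spaces of power series with square summable coefficients\<close>

lemma norm_closureE:
  assumes "f \<in> norm_closure H ip S" "e > 0"
  obtains g where "g \<in> S" "ip_norm ip (f - g) < e"
  using assms by (auto simp: norm_closure_def)

text \<open>
  A common frame for the disk and the bidisk: \<open>D\<close> is the domain, \<open>Tor\<close> its distinguished boundary, \<open>J\<close> the
  integral over \<open>Tor\<close>, \<open>dil r\<close> the dilation by \<open>r\<close>, and \<open>mon i\<close> the monomials, of degree \<open>deg i\<close>.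
\<close>

locale monomial_space =
  fixes D Tor :: "'x set" and mon :: "'i \<Rightarrow> 'x \<Rightarrow> complex" and deg :: "'i \<Rightarrow> nat"
    and dil :: "real \<Rightarrow> 'x \<Rightarrow> 'x" and J :: "('x \<Rightarrow> complex) \<Rightarrow> complex" and Hol :: "('x \<Rightarrow> complex) set"
  assumes deg_summable: "\<And>r::real. 0 \<le> r \<Longrightarrow> r < 1 \<Longrightarrow> (\<lambda>i. r ^ deg i) summable_on UNIV"
    and mon_le: "\<And>x. x \<in> D \<Longrightarrow> \<exists>r. 0 \<le> r \<and> r < 1 \<and> (\<forall>i. cmod (mon i x) \<le> r ^ deg i)"
    and dil_in: "\<And>x r. x \<in> Tor \<Longrightarrow> 0 < r \<Longrightarrow> r < 1 \<Longrightarrow> dil r x \<in> D"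
    and mon_dil: "\<And>i x r. mon i (dil r x) = of_real (r ^ deg i) * mon i x"
    and norm_mon_Tor: "\<And>i x. x \<in> Tor \<Longrightarrow> cmod (mon i x) = 1"
    and J_cong: "\<And>F G. (\<And>x. x \<in> Tor \<Longrightarrow> F x = G x) \<Longrightarrow> J F = J G"
    and J_series: "\<And>c. c summable_on UNIV \<Longrightarrow>
      J (\<lambda>x. \<Sum>\<^sub>\<infinity>k. c k * (mon (fst k) x * cnj (mon (snd k) x))) =
      (\<Sum>\<^sub>\<infinity>k. if fst k = snd k then c k else 0)"
    and Hol_series: "\<And>f. f \<in> Hol \<Longrightarrow> \<exists>a. (\<forall>r::real. 0 \<le> r \<and> r < 1 \<longrightarrow>
        (\<lambda>i. a i * of_real (r ^ deg i)) summable_on UNIV) \<and> (\<forall>x\<in>D. f x = (\<Sum>\<^sub>\<infinity>i. a i * mon i x))"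
    and series_Hol: "\<And>a. (\<And>r::real. 0 \<le> r \<Longrightarrow> r < 1 \<Longrightarrow>
        (\<lambda>i. a i * of_real (r ^ deg i)) summable_on UNIV) \<Longrightarrow>
        (\<lambda>x. if x \<in> D then \<Sum>\<^sub>\<infinity>i. a i * mon i x else 0) \<in> Hol"
begin

text \<open>The coefficient condition behind absolute convergence on all of \<open>D\<close>,
  through \<open>mon_le\<close>. It is weaker than \<open>ell2\<close> and is what membership in
  \<open>Hol\<close> alone provides.\<close>

definition disc_summable :: "('i \<Rightarrow> complex) \<Rightarrow> bool" where
  "disc_summable a \<longleftrightarrow> (\<forall>r::real. 0 \<le> r \<and> r < 1 \<longrightarrow> (\<lambda>i. a i * of_real (r ^ deg i)) summable_on UNIV)"

text \<open>The value \<open>0\<close> off \<open>D\<close> is the convention of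
  \<open>hardy\<close> and \<open>hardy2\<close>, so an element equals its series as a total
  function.\<close>

definition series :: "('i \<Rightarrow> complex) \<Rightarrow> 'x \<Rightarrow> complex" where
  "series a = (\<lambda>x. if x \<in> D then \<Sum>\<^sub>\<infinity>i. a i * mon i x else 0)"

text \<open>This and \<open>hinner\<close> copy the definitions of the Hardy spaces and their inner
  products with the parameters abstracted, so that both instances are recovered by
  unfolding.\<close>

definition hspace :: "('x \<Rightarrow> complex) set" where
  "hspace = {f. f \<in> Hol \<and> (\<forall>x. x \<notin> D \<longrightarrow> f x = 0) \<and>
     bdd_above ((\<lambda>r. Re (J (\<lambda>x. of_real ((cmod (f (dil r x)))\<^sup>2)))) ` {0<..<1})}"

definition hinner :: "('x \<Rightarrow> complex) \<Rightarrow> ('x \<Rightarrow> complex) \<Rightarrow> complex" where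
  "hinner f g = Lim (at_left (1 :: real)) (\<lambda>r. J (\<lambda>x. f (dil r x) * cnj (g (dil r x))))"

lemma disc_summable_mon:
  assumes "disc_summable a" "x \<in> D"
  shows "(\<lambda>i. a i * mon i x) summable_on UNIV"
proof -
  obtain r where r: "0 \<le> r" "r < 1" "\<And>i. cmod (mon i x) \<le> r ^ deg i"
    using mon_le[OF assms(2)] by blast
  have "(\<lambda>i. cmod (a i * of_real (r ^ deg i))) summable_on UNIV"
    using assms(1) r by (simp only: disc_summable_def flip: summable_on_iff_abs_summable_on_complex)
  moreover have "cmod (a i * mon i x) \<le> cmod (a i * of_real (r ^ deg i))" for i
    using r(1) r(3)[of i] by (simp add: norm_mult mult_left_mono norm_power)
  ultimately have "(\<lambda>i. cmod (a i * mon i x)) summable_on UNIV"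
    by (rule Infinite_Sum.abs_summable_on_comparison_test')
  then show ?thesis by (rule abs_summable_summable)
qed

lemma ell2_deg: "0 \<le> r \<Longrightarrow> r < 1 \<Longrightarrow> ell2 (\<lambda>i. of_real (r ^ deg i))"
  using deg_summable[of "r\<^sup>2"]
  by (simp add: ell2_def norm_power abs_square_less_1 power_even_eq flip: power_mult)

lemma ell2_disc_summable: "ell2 a \<Longrightarrow> disc_summable a"
  unfolding disc_summable_def by (auto intro: ell2_mult_summable ell2_deg simp del: of_real_power)

text \<open>Parseval's formula at radius \<open>r\<close>. Dilation multiplies each coefficient by
  \<open>r ^ deg i\<close>, which makes both series absolutely summable; their product is then a
  double series in \<open>mon i * cnj (mon j)\<close> that integrates term by term.\<close>

lemma J_series_mult:
  assumes "disc_summable a" "disc_summable b" "0 < r" "r < 1"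
  shows "J (\<lambda>x. series a (dil r x) * cnj (series b (dil r x))) =
    (\<Sum>\<^sub>\<infinity>i. a i * cnj (b i) * of_real (r ^ (2 * deg i)))"
proof -
  define A where "A = (\<lambda>i. a i * of_real (r ^ deg i))"
  define B where "B = (\<lambda>i. cnj (b i * of_real (r ^ deg i)))"
  have A: "A summable_on UNIV" and B: "B summable_on UNIV"
    using assms unfolding A_def B_def summable_on_cnj_iff disc_summable_def by (simp_all del: of_real_power)
  have summ: "(\<lambda>i. C i * e i) summable_on UNIV" if "C summable_on UNIV" "\<And>i. cmod (e i) = 1"
    for C e :: "'i \<Rightarrow> complex"
    using that by (simp add: summable_on_iff_abs_summable_on_complex norm_mult)
  have "J (\<lambda>x. series a (dil r x) * cnj (series b (dil r x))) =
      J (\<lambda>x. \<Sum>\<^sub>\<infinity>k. A (fst k) * B (snd k) * (mon (fst k) x * cnj (mon (snd k) x)))"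
  proof (rule J_cong)
    fix x assume x: "x \<in> Tor"
    have "series a (dil r x) * cnj (series b (dil r x)) =
        (\<Sum>\<^sub>\<infinity>i. A i * mon i x) * (\<Sum>\<^sub>\<infinity>i. B i * cnj (mon i x))"
      using x assms by (simp add: series_def dil_in mon_dil A_def B_def mult.assoc flip: infsum_cnj)
    also have "\<dots> = (\<Sum>\<^sub>\<infinity>k. (A (fst k) * mon (fst k) x) * (B (snd k) * cnj (mon (snd k) x)))"
      by (rule infsum_product[symmetric]) (auto intro!: summ A B simp: norm_mon_Tor x)
    finally show "series a (dil r x) * cnj (series b (dil r x)) =
        (\<Sum>\<^sub>\<infinity>k. A (fst k) * B (snd k) * (mon (fst k) x * cnj (mon (snd k) x)))"
      by (simp add: mult_ac)
  qed
  also have "\<dots> = (\<Sum>\<^sub>\<infinity>i. A i * B i)"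
    by (simp add: J_series summable_on_product[OF A B] infsum_diagonal)
  also have "\<dots> = (\<Sum>\<^sub>\<infinity>i. a i * cnj (b i) * of_real (r ^ (2 * deg i)))"
    unfolding A_def B_def mult_2 power_add of_real_mult complex_cnj_mult complex_cnj_complex_of_real
    by (simp only: mult_ac)
  finally show ?thesis .
qed

lemma J_series_norm:
  assumes "disc_summable a" "0 < r" "r < 1"
  shows "(\<lambda>i. (cmod (a i))\<^sup>2 * r ^ (2 * deg i)) summable_on UNIV"
    and "Re (J (\<lambda>x. of_real ((cmod (series a (dil r x)))\<^sup>2))) = (\<Sum>\<^sub>\<infinity>i. (cmod (a i))\<^sup>2 * r ^ (2 * deg i))"
proof -
  have s: "(\<lambda>i. cmod (a i * of_real (r ^ deg i))) summable_on UNIV"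
    using assms by (simp only: disc_summable_def flip: summable_on_iff_abs_summable_on_complex) auto
  \<comment> \<open>Each term is at most the whole sum, so the squares are at most \<open>B\<close>
    times the terms.\<close>
  then obtain B where B: "\<And>i. cmod (a i * of_real (r ^ deg i)) \<le> B"
    using finite_sum_le_infsum[of "\<lambda>i. cmod (a i * of_real (r ^ deg i))" UNIV "{_}"] by fastforce
  have "(\<lambda>i. B * cmod (a i * of_real (r ^ deg i))) summable_on UNIV"
    using s by (rule summable_on_cmult_right)
  then have "(\<lambda>i. (cmod (a i * of_real (r ^ deg i)))\<^sup>2) summable_on UNIV"
    by (rule summable_on_comparison_test) (auto simp: power2_eq_square simp del: of_real_power intro!: mult_right_mono B)
  then show s: "(\<lambda>i. (cmod (a i))\<^sup>2 * r ^ (2 * deg i)) summable_on UNIV"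
    using assms by (simp add: norm_mult norm_power power_mult_distrib mult.commute flip: power_mult)
  have "J (\<lambda>x. of_real ((cmod (series a (dil r x)))\<^sup>2)) =
      (\<Sum>\<^sub>\<infinity>i. of_real ((cmod (a i))\<^sup>2 * r ^ (2 * deg i)))"
    using J_series_mult[OF assms(1,1,2,3)]
    by (simp only: complex_norm_square of_real_mult)
  then show "Re (J (\<lambda>x. of_real ((cmod (series a (dil r x)))\<^sup>2))) =
      (\<Sum>\<^sub>\<infinity>i. (cmod (a i))\<^sup>2 * r ^ (2 * deg i))"
    using s by (simp only: infsum_complex_of_real Re_complex_of_real)
qed

section \<open>Membership and inner product in terms of coefficients\<close>

lemma series_in_hspace:
  assumes "ell2 a"
  shows "series a \<in> hspace"
proof -
  have a: "disc_summable a" using assms by (rule ell2_disc_summable)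
  have "series a \<in> Hol"
    unfolding series_def using a by (intro series_Hol) (simp add: disc_summable_def del: of_real_power)
  moreover have "Re (J (\<lambda>x. of_real ((cmod (series a (dil r x)))\<^sup>2))) \<le> (\<Sum>\<^sub>\<infinity>i. (cmod (a i))\<^sup>2)"
    if "0 < r" "r < 1" for r
  proof -
    have "(cmod (a i))\<^sup>2 * r ^ (2 * deg i) \<le> (cmod (a i))\<^sup>2" for i
      using that by (simp add: mult_left_le power_le_one)
    then show ?thesis
      using assms J_series_norm[OF a that] by (auto simp: ell2_def intro!: infsum_mono)
  qed
  ultimately show ?thesis
    by (auto simp: hspace_def intro!: bdd_aboveI2) (simp_all add: series_def)
qed

text \<open>Square summability is not known yet, so the limit r = 1 is taken in a finite partial
  sum, which is continuous in \<open>r\<close>; the bound \<open>C\<close> on the integral means is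
  inherited by every such sum.\<close>

lemma hspaceE:
  assumes "f \<in> hspace"
  obtains a where "ell2 a" "f = series a"
proof -
  obtain a where a: "disc_summable a" "\<And>x. x \<in> D \<Longrightarrow> f x = (\<Sum>\<^sub>\<infinity>i. a i * mon i x)"
    using assms Hol_series[of f] unfolding hspace_def disc_summable_def by blast
  have f: "f = series a"
    using a assms by (auto simp: series_def hspace_def fun_eq_iff)
  obtain C where C: "\<And>r. 0 < r \<Longrightarrow> r < 1 \<Longrightarrow> Re (J (\<lambda>x. of_real ((cmod (f (dil r x)))\<^sup>2))) \<le> C"
    using assms unfolding hspace_def bdd_above_def by fastforce
  have "(\<Sum>i\<in>F. (cmod (a i))\<^sup>2) \<le> C" if F: "finite F" for F
  proof (rule tendsto_upperbound)
    have "((\<lambda>r::real. \<Sum>i\<in>F. (cmod (a i))\<^sup>2 * r ^ (2 * deg i)) \<longlongrightarrow> (\<Sum>i\<in>F. (cmod (a i))\<^sup>2 * 1 ^ (2 * deg i))) (at_left 1)"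
      by (intro tendsto_intros)
    then show "((\<lambda>r::real. \<Sum>i\<in>F. (cmod (a i))\<^sup>2 * r ^ (2 * deg i)) \<longlongrightarrow> (\<Sum>i\<in>F. (cmod (a i))\<^sup>2)) (at_left 1)"
      by simp
    have "(\<Sum>i\<in>F. (cmod (a i))\<^sup>2 * r ^ (2 * deg i)) \<le> C" if "0 < r" "r < 1" for r
    proof -
      have "(\<Sum>i\<in>F. (cmod (a i))\<^sup>2 * r ^ (2 * deg i)) \<le> (\<Sum>\<^sub>\<infinity>i. (cmod (a i))\<^sup>2 * r ^ (2 * deg i))"
        using J_series_norm(1)[OF a(1) that] F that by (intro finite_sum_le_infsum) auto
      then show ?thesis using C[OF that] J_series_norm(2)[OF a(1) that] by (simp add: f)
    qed
    then show "\<forall>\<^sub>F r in at_left 1. (\<Sum>i\<in>F. (cmod (a i))\<^sup>2 * r ^ (2 * deg i)) \<le> C"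
      by (intro eventually_at_leftI[of 0]) auto
  qed simp
  then have "ell2 a"
    unfolding ell2_def by (intro nonneg_bdd_above_summable_on) (auto intro!: bdd_aboveI[of _ C])
  then show thesis using f that by blast
qed

text \<open>An Abel type argument: the terms are dominated by \<open>cmod (a i * cnj (b i))\<close>
  for all \<open>r\<close> in [0, 1], so \<open>h\<close> is continuous up to the endpoint. Hence
  the limit in \<open>hinner\<close> exists and equals \<open>h 1\<close>.\<close>

lemma hinner_series:
  assumes "ell2 a" "ell2 b"
  shows "hinner (series a) (series b) = (\<Sum>\<^sub>\<infinity>i. a i * cnj (b i))"
proof -
  define h where "h = (\<lambda>r::real. \<Sum>\<^sub>\<infinity>i. a i * cnj (b i) * of_real (r ^ (2 * deg i)))"
  have "(\<lambda>i. cmod (a i * cnj (b i))) summable_on UNIV"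
    using ell2_mult_cnj_summable[OF assms] by (simp add: summable_on_iff_abs_summable_on_complex)
  then have "uniform_limit {0..1} (\<lambda>F r. \<Sum>i\<in>F. a i * cnj (b i) * of_real (r ^ (2 * deg i))) h
      (finite_subsets_at_top UNIV)"
    unfolding h_def
    by (rule Weierstrass_m_test_general[rotated])
      (auto simp: norm_mult norm_power intro!: mult_left_le power_le_one)
  then have "continuous_on {0..1} h"
    by (rule uniform_limit_theorem[rotated])
      (auto intro!: always_eventually continuous_intros)
  then have "(h \<longlongrightarrow> h 1) (at 1 within {0..1})"
    by (simp add: continuous_on_def)
  then have "(h \<longlongrightarrow> h 1) (at_left 1)"
    using at_within_Icc_at_left[of 0 "1::real"] by simp
  moreover have "\<forall>\<^sub>F r in at_left 1. h r = J (\<lambda>x. series a (dil r x) * cnj (series b (dil r x)))"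
    using assms by (intro eventually_at_leftI[of 0]) (auto simp: h_def J_series_mult ell2_disc_summable)
  ultimately have "((\<lambda>r. J (\<lambda>x. series a (dil r x) * cnj (series b (dil r x)))) \<longlongrightarrow> h 1) (at_left 1)"
    by (rule Lim_transform_eventually)
  then have "hinner (series a) (series b) = h 1"
    unfolding hinner_def by (intro tendsto_Lim) auto
  then show ?thesis by (simp add: h_def)
qed

lemma ip_norm_series:
  assumes "ell2 a"
  shows "ip_norm hinner (series a) = sqrt (\<Sum>\<^sub>\<infinity>i. (cmod (a i))\<^sup>2)"
proof -
  have "hinner (series a) (series a) = (\<Sum>\<^sub>\<infinity>i. of_real ((cmod (a i))\<^sup>2))"
    using assms by (simp only: hinner_series complex_norm_square)
  also have "\<dots> = of_real (\<Sum>\<^sub>\<infinity>i. (cmod (a i))\<^sup>2)"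
    by (rule infsum_complex_of_real) (use assms in \<open>simp add: ell2_def\<close>)
  finally show ?thesis by (simp add: ip_norm_def)
qed

section \<open>Linear structure and closures of subspaces\<close>

lemma series_0: "series (\<lambda>_. 0) = 0"
  by (simp add: series_def fun_eq_iff)

lemma series_add:
  "ell2 a \<Longrightarrow> ell2 b \<Longrightarrow> series (\<lambda>i. a i + b i) = series a + series b"
  by (simp add: series_def fun_eq_iff distrib_right infsum_add disc_summable_mon ell2_disc_summable)

lemma series_scale: "series (\<lambda>i. c * a i) = fscale c (series a)"
  by (simp add: series_def fun_eq_iff fscale_def mult.assoc infsum_cmult_right')

lemma series_diff:
  "ell2 a \<Longrightarrow> ell2 b \<Longrightarrow> series (\<lambda>i. a i - b i) = series a - series b"
  using series_add[of a "\<lambda>i. -1 * b i"] series_scale[of "-1" b] ell2_scale[of b "-1"]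
  by (simp add: fscale_def fun_eq_iff)

lemma hspace_add: "f \<in> hspace \<Longrightarrow> g \<in> hspace \<Longrightarrow> f + g \<in> hspace"
  by (elim hspaceE) (auto simp flip: series_add intro!: series_in_hspace ell2_add)

lemma hspace_diff: "f \<in> hspace \<Longrightarrow> g \<in> hspace \<Longrightarrow> f - g \<in> hspace"
  by (elim hspaceE) (auto simp flip: series_diff intro!: series_in_hspace ell2_diff)

lemma hspace_scale: "f \<in> hspace \<Longrightarrow> fscale c f \<in> hspace"
  by (elim hspaceE) (auto simp flip: series_scale intro!: series_in_hspace ell2_scale)

lemma ip_norm_add_le:
  assumes "f \<in> hspace" "g \<in> hspace"
  shows "ip_norm hinner (f + g) \<le> ip_norm hinner f + ip_norm hinner g"
proof -
  obtain a b where ab: "ell2 a" "f = series a" "ell2 b" "g = series b"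
    using assms by (elim hspaceE)
  then show ?thesis
    using ell2_triangle[of a b] by (simp add: ip_norm_series ell2_add flip: series_add)
qed

lemma ip_norm_scale:
  assumes "f \<in> hspace"
  shows "ip_norm hinner (fscale c f) = cmod c * ip_norm hinner f"
proof -
  obtain a where a: "ell2 a" "f = series a" using assms by (elim hspaceE)
  then show ?thesis
    by (simp add: ip_norm_series ell2_scale norm_mult power_mult_distrib infsum_cmult_right'
        real_sqrt_mult flip: series_scale)
qed

lemma ip_norm_0: "ip_norm hinner 0 = 0"
  using ip_norm_series[of "\<lambda>_. 0"] by (simp add: series_0)

lemma closed_subspace_norm_closure:
  assumes "S \<subseteq> hspace" "cfun.subspace S"
  shows "closed_subspace hspace hinner (norm_closure hspace hinner S)"
  unfolding closed_subspace_def
proof (intro conjI)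
  let ?C = "norm_closure hspace hinner S"
  have sub: "S \<subseteq> norm_closure hspace hinner S" if "S \<subseteq> hspace" for S
  proof
    fix f assume "f \<in> S"
    moreover have "ip_norm hinner (f - f) = 0" by (simp add: ip_norm_0)
    ultimately show "f \<in> norm_closure hspace hinner S"
      using that ip_norm_0 by (auto simp: norm_closure_def intro!: bexI[of _ f])
  qed
  show "?C \<subseteq> hspace" by (auto simp: norm_closure_def)
  show "norm_closure hspace hinner ?C = ?C"
  proof
    show "?C \<subseteq> norm_closure hspace hinner ?C"
      by (rule sub) (auto simp: norm_closure_def)
    show "norm_closure hspace hinner ?C \<subseteq> ?C"
    proof
      fix f assume f: "f \<in> norm_closure hspace hinner ?C"
      have "\<exists>h\<in>S. ip_norm hinner (f - h) < e" if e: "e > 0" for e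
      proof -
        obtain g where g: "g \<in> ?C" "ip_norm hinner (f - g) < e / 2"
          using norm_closureE[OF f, of "e / 2"] e by auto
        obtain h where h: "h \<in> S" "ip_norm hinner (g - h) < e / 2"
          using norm_closureE[OF g(1), of "e / 2"] e by auto
        have "ip_norm hinner ((f - g) + (g - h)) \<le> ip_norm hinner (f - g) + ip_norm hinner (g - h)"
          using f g h assms(1) by (intro ip_norm_add_le hspace_diff) (auto simp: norm_closure_def)
        then show ?thesis using g h by (intro bexI[of _ h]) auto
      qed
      then show "f \<in> ?C" using f by (auto simp: norm_closure_def)
    qed
  qed
  show "cfun.subspace ?C"
  proof (rule cfun.subspaceI)
    show "0 \<in> ?C" using sub[OF assms(1)] cfun.subspace_0[OF assms(2)] by auto
  next
    fix f g assume fg: "f \<in> ?C" "g \<in> ?C"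
    have "\<exists>h\<in>S. ip_norm hinner (f + g - h) < e" if e: "e > 0" for e
    proof -
      obtain f' where f': "f' \<in> S" "ip_norm hinner (f - f') < e / 2"
        using norm_closureE[OF fg(1), of "e / 2"] e by auto
      obtain g' where g': "g' \<in> S" "ip_norm hinner (g - g') < e / 2"
        using norm_closureE[OF fg(2), of "e / 2"] e by auto
      have "ip_norm hinner ((f - f') + (g - g')) \<le> ip_norm hinner (f - f') + ip_norm hinner (g - g')"
        using fg f' g' assms(1) by (intro ip_norm_add_le hspace_diff) (auto simp: norm_closure_def)
      then show ?thesis
        using f' g' assms(2) by (intro bexI[of _ "f' + g'"]) (auto simp: cfun.subspace_add algebra_simps)
    qed
    then show "f + g \<in> ?C" using fg by (auto simp: norm_closure_def hspace_add)
  next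
    fix c f assume f: "f \<in> ?C"
    have "\<exists>h\<in>S. ip_norm hinner (fscale c f - h) < e" if e: "e > 0" for e
    proof -
      \<comment> \<open>Dividing by \<open>cmod c + 1\<close> instead of \<open>cmod c\<close>
        covers c = 0 as well.\<close>
      have "e / (cmod c + 1) > 0" using e by (simp add: add_nonneg_pos)
      then obtain f' where f': "f' \<in> S" "ip_norm hinner (f - f') < e / (cmod c + 1)"
        using norm_closureE[OF f] by blast
      have "ip_norm hinner (fscale c (f - f')) = cmod c * ip_norm hinner (f - f')"
        using f f' assms(1) by (intro ip_norm_scale hspace_diff) (auto simp: norm_closure_def)
      also have "\<dots> \<le> cmod c * (e / (cmod c + 1))"
        using f' by (intro mult_left_mono) auto
      also have "\<dots> < (cmod c + 1) * (e / (cmod c + 1))"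
        using \<open>e / (cmod c + 1) > 0\<close> by (intro mult_strict_right_mono) auto
      also have "\<dots> = e" using norm_ge_zero[of c] by (simp add: add_nonneg_eq_0_iff)
      finally show ?thesis
        using f' assms(2)
        by (intro bexI[of _ "fscale c f'"]) (auto simp: cfun.subspace_scale cfun.scale_right_diff_distrib)
    qed
    then show "fscale c f \<in> ?C" using f by (auto simp: norm_closure_def hspace_scale)
  qed
qed

section \<open>Adjoints of shifts and their invariant subspaces\<close>

lemma adjoint_on_series:
  assumes "inj \<sigma>"
    and T: "\<And>b. ell2 b \<Longrightarrow> \<exists>b'. ell2 b' \<and> T (series b) = series b' \<and> (\<forall>i. b' (\<sigma> i) = b i) \<and>
      (\<forall>j. j \<notin> range \<sigma> \<longrightarrow> b' j = 0)"
    and a: "ell2 a"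
  shows "adjoint_on hspace hinner T (series a) = series (a \<circ> \<sigma>)"
  unfolding adjoint_on_def
proof (rule the_equality)
  have a\<sigma>: "ell2 (a \<circ> \<sigma>)" using assms(1) a by (rule ell2_comp_inj)
  \<comment> \<open>\<open>T\<close> puts the coefficient \<open>b i\<close> at position
    \<open>\<sigma> i\<close> and \<open>0\<close> elsewhere, so pairing with
    \<open>T (series b)\<close> sees only the coefficients of \<open>a\<close> along
    \<open>range \<sigma>\<close>.\<close>
  have adj: "hinner (series (a \<circ> \<sigma>)) (series b) = hinner (series a) (T (series b))" if b: "ell2 b" for b
  proof -
    obtain b' where b': "ell2 b'" "T (series b) = series b'" "\<And>i. b' (\<sigma> i) = b i"
      "\<And>j. j \<notin> range \<sigma> \<Longrightarrow> b' j = 0"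
      using T[OF b] by blast
    have "(\<Sum>\<^sub>\<infinity>i. a i * cnj (b' i)) = (\<Sum>\<^sub>\<infinity>i\<in>range \<sigma>. a i * cnj (b' i))"
      by (rule infsum_cong_neutral) (use b' in auto)
    also have "\<dots> = (\<Sum>\<^sub>\<infinity>i. (a \<circ> \<sigma>) i * cnj (b i))"
      using assms(1) b' by (simp add: infsum_reindex o_def)
    finally show ?thesis using a b b' a\<sigma> by (simp add: hinner_series)
  qed
  show *: "series (a \<circ> \<sigma>) \<in> hspace \<and> (\<forall>k\<in>hspace. hinner (series (a \<circ> \<sigma>)) k = hinner (series a) (T k))"
    using a\<sigma> adj by (auto intro: series_in_hspace elim!: hspaceE)
  fix h assume h: "h \<in> hspace \<and> (\<forall>k\<in>hspace. hinner h k = hinner (series a) (T k))"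
  then obtain c where c: "ell2 c" "h = series c" by (blast elim: hspaceE)
  \<comment> \<open>\<open>THE\<close> in \<open>adjoint_on\<close> demands uniqueness: testing a
    rival \<open>h\<close> against the difference of the two series shows that this difference has
    norm zero.\<close>
  define d where "d = (\<lambda>i. c i - (a \<circ> \<sigma>) i)"
  have d: "ell2 d" unfolding d_def using c a\<sigma> by (intro ell2_diff)
  have "hinner h (series d) = hinner (series (a \<circ> \<sigma>)) (series d)"
    using h * d by (simp add: series_in_hspace)
  then have "hinner (series d) (series d) = 0"
    using c d a\<sigma> infsum_add[OF ell2_mult_cnj_summable ell2_mult_cnj_summable[OF ell2_scale], of c d "a \<circ> \<sigma>" d "-1"]
    by (simp add: hinner_series d_def left_diff_distrib infsum_uminus)
  then have "(\<Sum>\<^sub>\<infinity>i. (cmod (d i))\<^sup>2) = 0"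
    using ip_norm_series[OF d] by (simp add: ip_norm_def)
  then have "(cmod (d i))\<^sup>2 = 0" for i
    using d by (intro nonneg_infsum_le_0D[where A = UNIV]) (auto simp: ell2_def)
  then have "c = a \<circ> \<sigma>" by (simp add: d_def fun_eq_iff)
  then show "h = series (a \<circ> \<sigma>)" using c by simp
qed

lemma invariant_subspace_norm_closure:
  assumes S: "S \<subseteq> hspace" "cfun.subspace S" "A ` S \<subseteq> S"
    and "inj \<sigma>" and A: "\<And>a. ell2 a \<Longrightarrow> A (series a) = series (a \<circ> \<sigma>)"
  shows "invariant_subspace hspace hinner A (norm_closure hspace hinner S)"
  unfolding invariant_subspace_def
proof (intro conjI closed_subspace_norm_closure S(1,2) image_subsetI)
  fix f assume f: "f \<in> norm_closure hspace hinner S"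
  then obtain a where a: "ell2 a" "f = series a" by (auto simp: norm_closure_def elim: hspaceE)
  have a\<sigma>: "ell2 (a \<circ> \<sigma>)" using assms(4) a(1) by (rule ell2_comp_inj)
  have "\<exists>h\<in>S. ip_norm hinner (A f - h) < e" if e: "e > 0" for e
  proof -
    \<comment> \<open>\<open>A\<close> reads coefficients along \<open>\<sigma>\<close> and cannot
      increase norms, so \<open>A g\<close> approximates \<open>A f\<close> within the same
      \<open>e\<close>.\<close>
    obtain g where g: "g \<in> S" "ip_norm hinner (f - g) < e"
      using f e by (auto simp: norm_closure_def)
    then obtain b where b: "ell2 b" "g = series b" using S(1) by (blast elim: hspaceE)
    have b\<sigma>: "ell2 (b \<circ> \<sigma>)" using assms(4) b(1) by (rule ell2_comp_inj)
    define d where "d = (\<lambda>i. a i - b i)"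
    have d: "ell2 d" "ell2 (d \<circ> \<sigma>)"
      unfolding d_def using a b assms(4) by (auto intro: ell2_diff ell2_comp_inj)
    have "A f - A g = series (d \<circ> \<sigma>)"
      using series_diff[OF a\<sigma> b\<sigma>] by (simp add: a b A d_def o_def)
    then have "ip_norm hinner (A f - A g) \<le> sqrt (\<Sum>\<^sub>\<infinity>i. (cmod (d i))\<^sup>2)"
      using ell2_comp_inj_le[OF assms(4) d(1)] d by (simp add: ip_norm_series)
    also have "\<dots> = ip_norm hinner (f - g)"
      using d a b by (simp add: d_def flip: series_diff ip_norm_series)
    finally show ?thesis using g S(3) by (intro bexI[of _ "A g"]) auto
  qed
  then show "A f \<in> norm_closure hspace hinner S"
    using a a\<sigma> by (auto simp: norm_closure_def A intro: series_in_hspace)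
qed

text \<open>Covers both shifts: multiplication by z takes \<open>z ^ n\<close> to
  \<open>z ^ Suc n\<close>, and on the bidisk it raises the first exponent only.\<close>

lemma adjoint_on_mult:
  assumes "inj \<sigma>" and \<mu>: "\<And>i x. mon (\<sigma> i) x = \<mu> x * mon i x" and "ell2 a"
  shows "adjoint_on hspace hinner (\<lambda>f x. \<mu> x * f x) (series a) = series (a \<circ> \<sigma>)"
proof (rule adjoint_on_series)
  fix b :: "'i \<Rightarrow> complex" assume b: "ell2 b"
  \<comment> \<open>Coefficients of the product: those of \<open>b\<close> pushed forward along
    \<open>\<sigma>\<close>, and \<open>0\<close> at the monomials that multiplication by
    \<open>\<mu>\<close> does not reach.\<close>
  define b' where "b' = (\<lambda>j. if j \<in> range \<sigma> then b (inv \<sigma> j) else 0)"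
  have b'\<sigma>: "b' (\<sigma> i) = b i" for i using assms(1) by (simp add: b'_def)
  have "(\<lambda>j. (cmod (b' j))\<^sup>2) summable_on range \<sigma>"
    using b assms(1) b'\<sigma> by (simp add: summable_on_reindex o_def ell2_def)
  then have "ell2 b'"
    unfolding ell2_def by (rule summable_on_cong_neutral[THEN iffD1, rotated -1]) (auto simp: b'_def)
  moreover have "\<mu> x * series b x = series b' x" for x
  proof -
    have "(\<Sum>\<^sub>\<infinity>j. b' j * mon j x) = (\<Sum>\<^sub>\<infinity>j\<in>range \<sigma>. b' j * mon j x)"
      by (rule infsum_cong_neutral) (auto simp: b'_def)
    also have "\<dots> = \<mu> x * (\<Sum>\<^sub>\<infinity>i. b i * mon i x)"
      using assms(1) b'\<sigma> by (simp add: infsum_reindex o_def \<mu> mult.left_commute infsum_cmult_right')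
    finally show ?thesis by (simp add: series_def)
  qed
  ultimately show "\<exists>b'. ell2 b' \<and> (\<lambda>x. \<mu> x * series b x) = series b' \<and> (\<forall>i. b' (\<sigma> i) = b i) \<and>
      (\<forall>j. j \<notin> range \<sigma> \<longrightarrow> b' j = 0)"
    using b'\<sigma> by (intro exI[of _ b']) (auto simp: b'_def)
qed (use assms in auto)

end

subsection \<open>Fourier integrals and power series on the disk and the bidisk\<close>

lemma circle_integral_cong:
  assumes "\<And>z. z \<in> sphere 0 1 \<Longrightarrow> F z = G z"
  shows "circle_integral F = circle_integral G"
  unfolding circle_integral_def using assms by (simp cong: integral_cong)

text \<open>For \<open>p \<noteq> q\<close> the integrand winds \<open>p - q\<close> times around
  the circle, and its antiderivative takes equal values at both ends of the period.\<close>

lemma circle_integral_monomial: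
  "circle_integral (\<lambda>z. z ^ p * cnj (z ^ q)) = (if p = q then 1 else 0)"
proof (cases "p = q")
  case True
  have "cis t ^ p * cnj (cis t ^ p) = 1" for t
    by (simp add: cis_cnj cis_mult flip: power_mult_distrib)
  then show ?thesis using True by (simp add: circle_integral_def scaleR_conv_of_real)
next
  case False
  \<comment> \<open>A real difference, since it may be negative.\<close>
  define k where "k = real p - real q"
  have k: "k \<noteq> 0" "k \<in> \<int>" using False by (auto simp: k_def)
  have eq: "cis t ^ p * cnj (cis t ^ q) = exp (\<i> * of_real k * of_real t)" for t
  proof -
    have "cis t ^ p * cnj (cis t ^ q) = cis (k * t)"
      unfolding complex_cnj_power cis_cnj Complex.DeMoivre cis_mult by (simp add: k_def left_diff_distrib)
    then show ?thesis by (simp add: cis_conv_exp mult.assoc)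
  qed
  have "((\<lambda>t. exp (\<i> * of_real k * of_real t)) has_integral
      exp (\<i> * of_real k * of_real (2 * pi)) / (\<i> * of_real k) - exp (\<i> * of_real k * of_real 0) / (\<i> * of_real k))
      {0..2 * pi}"
    by (rule fundamental_theorem_of_calculus)
      (use k in \<open>auto intro!: derivative_eq_intros has_vector_derivative_real_field\<close>)
  moreover have "exp (\<i> * of_real k * of_real (2 * pi)) = 1"
    using cis_multiple_2pi[OF k(2)] by (simp add: cis_conv_exp mult_ac)
  ultimately show ?thesis
    using False by (simp only: circle_integral_def eq) (simp add: integral_unique)
qed

text \<open>The moduli \<open>cmod (c k)\<close> are a Weierstrass majorant on the circle, so the
  finite partial sums converge uniformly and the integral passes to the limit.\<close>

lemma circle_integral_infsum:
  assumes c: "c summable_on UNIV"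
    and cont: "\<And>k. continuous_on (sphere 0 1) (e k)"
    and le: "\<And>k z. z \<in> sphere 0 1 \<Longrightarrow> cmod (e k z) \<le> 1"
  shows "circle_integral (\<lambda>z. \<Sum>\<^sub>\<infinity>k. c k * e k z) = (\<Sum>\<^sub>\<infinity>k. c k * circle_integral (e k))"
proof -
  have conte: "continuous_on {0..2 * pi} (\<lambda>t. e k (cis t))" for k
    by (rule continuous_on_compose2[OF cont]) (auto intro!: continuous_intros)
  have "(\<lambda>k. cmod (c k)) summable_on UNIV"
    using c by (simp add: summable_on_iff_abs_summable_on_complex)
  then have "uniform_limit {0..2 * pi} (\<lambda>F t. \<Sum>k\<in>F. c k * e k (cis t))
      (\<lambda>t. \<Sum>\<^sub>\<infinity>k. c k * e k (cis t)) (finite_subsets_at_top UNIV)"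
    by (rule Weierstrass_m_test_general[rotated]) (auto simp: norm_mult intro!: mult_left_le le)
  then obtain I L where I: "\<And>F. ((\<lambda>t. \<Sum>k\<in>F. c k * e k (cis t)) has_integral I F) {0..2 * pi}"
    and L: "((\<lambda>t. \<Sum>\<^sub>\<infinity>k. c k * e k (cis t)) has_integral L) {0..2 * pi}"
    and lim: "(I \<longlongrightarrow> L) (finite_subsets_at_top UNIV)"
    by (rule uniform_limit_integral) (auto intro!: continuous_intros conte)
  have "I F / of_real (2 * pi) = (\<Sum>k\<in>F. c k * circle_integral (e k))" for F
  proof -
    have "I F = integral {0..2 * pi} (\<lambda>t. \<Sum>k\<in>F. c k * e k (cis t))"
      by (rule integral_unique[symmetric, OF I])
    also have "\<dots> = (\<Sum>k\<in>F. c k * integral {0..2 * pi} (\<lambda>t. e k (cis t)))"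
    \<comment> \<open>The identity is claimed for every set \<open>F\<close>; for an infinite one
      both sums are \<open>0\<close> by convention.\<close>
    proof (cases "finite F")
      case True
      then show ?thesis
        by (subst integral_sum) (auto intro!: integrable_continuous_interval continuous_intros conte)
    qed simp
    finally show ?thesis by (simp add: circle_integral_def sum_divide_distrib)
  qed
  moreover have "((\<lambda>F. I F / of_real (2 * pi)) \<longlongrightarrow> L / of_real (2 * pi)) (finite_subsets_at_top UNIV)"
    by (intro tendsto_intros lim) auto
  ultimately have "((\<lambda>k. c k * circle_integral (e k)) has_sum L / of_real (2 * pi)) UNIV"
    by (simp add: has_sum_def)
  then show ?thesis
    using L by (simp add: infsumI circle_integral_def integral_unique)
qed

section \<open>Locally uniform sums on the disk and the bidisk\<close>

lemma UN_ball_radius_less_1: "(\<Union>R\<in>{0<..<1}. ball 0 R) = ball (0::complex) 1"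
proof (intro equalityI subsetI)
  fix z :: complex assume "z \<in> ball 0 1"
  then show "z \<in> (\<Union>R\<in>{0<..<1}. ball 0 R)"
    by (intro UN_I[of "(cmod z + 1) / 2"]) (auto simp: add_nonneg_pos)
qed auto

text \<open>Weierstrass's theorem on each disk of radius R < 1, with a majorant that may depend on
  \<open>R\<close>. Holomorphy is local, so these disks suffice.\<close>

lemma holomorphic_on_infsum:
  assumes hol: "\<And>i. f i holomorphic_on ball 0 1"
    and bound: "\<And>R. 0 < R \<Longrightarrow> R < 1 \<Longrightarrow> \<exists>B. B summable_on UNIV \<and> (\<forall>i. \<forall>z\<in>cball 0 R. cmod (f i z) \<le> B i)"
  shows "(\<lambda>z. \<Sum>\<^sub>\<infinity>i. f i z) holomorphic_on ball 0 1"
proof -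
  have "(\<lambda>z. \<Sum>\<^sub>\<infinity>i. f i z) holomorphic_on ball 0 R" if R: "R \<in> {0<..<1}" for R
  proof -
    obtain B where B: "B summable_on UNIV" "\<And>i z. z \<in> cball 0 R \<Longrightarrow> cmod (f i z) \<le> B i"
      using bound[of R] R by auto
    have "uniform_limit (cball 0 R) (\<lambda>F z. \<Sum>i\<in>F. f i z) (\<lambda>z. \<Sum>\<^sub>\<infinity>i. f i z) (finite_subsets_at_top UNIV)"
      using B by (intro Weierstrass_m_test_general) auto
    moreover have hF: "(\<lambda>z. \<Sum>i\<in>F. f i z) holomorphic_on ball 0 1" for F
      by (intro holomorphic_intros hol)
    have "cball 0 R \<subseteq> ball (0::complex) 1" "ball 0 R \<subseteq> ball (0::complex) 1" using R by auto
    then have "continuous_on (cball 0 R) (\<lambda>z. \<Sum>i\<in>F. f i z) \<and> (\<lambda>z. \<Sum>i\<in>F. f i z) holomorphic_on ball 0 R" for F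
      using hF[of F] by (meson holomorphic_on_imp_continuous_on holomorphic_on_subset)
    ultimately show ?thesis
      by (elim holomorphic_uniform_limit[rotated]) (auto intro: always_eventually)
  qed
  then have "(\<lambda>z. \<Sum>\<^sub>\<infinity>i. f i z) holomorphic_on (\<Union>R\<in>{0<..<1}. ball 0 R)"
    by (intro holomorphic_on_UN_open) auto
  then show ?thesis by (simp only: UN_ball_radius_less_1)
qed

lemma continuous_on_bidisk_infsum:
  fixes f :: "'i \<Rightarrow> complex \<times> complex \<Rightarrow> complex"
  assumes cont: "\<And>i. continuous_on (\<bbbD> \<times> \<bbbD>) (f i)"
    and bound: "\<And>R. 0 < R \<Longrightarrow> R < 1 \<Longrightarrow>
      \<exists>B. B summable_on UNIV \<and> (\<forall>i. \<forall>p\<in>cball 0 R \<times> cball 0 R. cmod (f i p) \<le> B i)"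
  shows "continuous_on (\<bbbD> \<times> \<bbbD>) (\<lambda>p. \<Sum>\<^sub>\<infinity>i. f i p)"
proof -
  have "continuous_on (ball 0 R \<times> ball 0 R) (\<lambda>p. \<Sum>\<^sub>\<infinity>i. f i p)" if R: "R \<in> {0<..<1}" for R
  proof -
    obtain B where B: "B summable_on UNIV" "\<And>i p. p \<in> cball 0 R \<times> cball 0 R \<Longrightarrow> cmod (f i p) \<le> B i"
      using bound[of R] R by auto
    have "uniform_limit (ball 0 R \<times> ball 0 R) (\<lambda>F p. \<Sum>i\<in>F. f i p) (\<lambda>p. \<Sum>\<^sub>\<infinity>i. f i p) (finite_subsets_at_top UNIV)"
      using B by (intro Weierstrass_m_test_general) auto
    moreover have "continuous_on (ball 0 R \<times> ball 0 R) (f i)" for i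
      using R by (intro continuous_on_subset[OF cont]) auto
    ultimately show ?thesis
      by (elim uniform_limit_theorem[rotated]) (auto intro!: always_eventually continuous_intros)
  qed
  then have "continuous_on (\<Union>R\<in>{0<..<1}. ball 0 R \<times> ball 0 R) (\<lambda>p. \<Sum>\<^sub>\<infinity>i. f i p)"
    by (intro continuous_on_open_UN) (auto intro: open_Times)
  moreover have "(\<Union>R\<in>{0<..<1}. ball 0 R \<times> ball 0 R) = \<bbbD> \<times> \<bbbD>"
  proof (intro equalityI subsetI)
    fix p :: "complex \<times> complex" assume p: "p \<in> \<bbbD> \<times> \<bbbD>"
    define m where "m = max (cmod (fst p)) (cmod (snd p))"
    have "0 \<le> m" "m < 1" "cmod (fst p) \<le> m" "cmod (snd p) \<le> m" using p by (auto simp: m_def le_max_iff_disj)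
    then show "p \<in> (\<Union>R\<in>{0<..<1}. ball 0 R \<times> ball 0 R)"
      by (intro UN_I[of "(m + 1) / 2"]) (auto simp: mem_Times_iff)
  qed auto
  ultimately show ?thesis by simp
qed

section \<open>Taylor coefficients and their dependence on a parameter\<close>

definition taylor :: "(complex \<Rightarrow> complex) \<Rightarrow> nat \<Rightarrow> complex" where
  "taylor f n = (deriv ^^ n) f 0 / fact n"

lemma has_sum_taylor:
  assumes "f holomorphic_on ball 0 1" "z \<in> ball 0 1"
  shows "((\<lambda>n. taylor f n * z ^ n) has_sum f z) UNIV"
proof (rule norm_summable_imp_has_sum)
  have sums: "(\<lambda>n. taylor f n * u ^ n) sums f u" if "u \<in> ball 0 1" for u
    using holomorphic_power_series[OF assms(1) that] by (simp add: taylor_def)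
  then show "(\<lambda>n. taylor f n * z ^ n) sums f z" using assms(2) .
  \<comment> \<open>A point of larger modulus inside the disk: convergence there gives absolute
    convergence at \<open>z\<close>.\<close>
  define x :: complex where "x = of_real ((cmod z + 1) / 2)"
  have x: "cmod x = (cmod z + 1) / 2" unfolding x_def norm_of_real by (simp add: add_nonneg_nonneg)
  have "summable (\<lambda>n. taylor f n * x ^ n)"
    using sums[of x] x assms(2) by (auto simp: sums_iff)
  then show "summable (\<lambda>n. norm (taylor f n * z ^ n))"
    by (rule powser_insidea) (use x assms(2) in auto)
qed

lemma taylor_bound:
  assumes "f holomorphic_on ball 0 1" "0 < R" "R < 1" "\<And>z. z \<in> cball 0 R \<Longrightarrow> cmod (f z) \<le> B"
  shows "cmod (taylor f n) \<le> B / R ^ n"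
proof -
  have "cmod ((deriv ^^ n) f 0) \<le> fact n * B / R ^ n"
  proof (rule Cauchy_inequality)
    show "f holomorphic_on ball 0 R" "continuous_on (cball 0 R) f"
      using assms(2,3) by (auto intro!: holomorphic_on_imp_continuous_on holomorphic_on_subset[OF assms(1)])
  qed (use assms in auto)
  then show ?thesis by (simp add: taylor_def norm_divide field_simps)
qed

text \<open>
  By induction: the coefficient of \<open>z ^ m\<close> is the limit, locally uniform in \<open>w\<close>, of \<open>f(h, w) / h ^ m\<close> minus the
  terms of lower order as \<open>h\<close> decreases to \<open>0\<close>; Cauchy's estimates control the error.
\<close>

lemma holomorphic_on_taylor:
  assumes f: "holomorphic_on_bidisk f"
  shows "(\<lambda>w. taylor (\<lambda>z. f (z, w)) m) holomorphic_on \<bbbD>"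
proof (induction m rule: less_induct)
  case (less m)
  define A where "A = (\<lambda>m w. taylor (\<lambda>z. f (z, w)) m)"
  have fz: "(\<lambda>z. f (z, w)) holomorphic_on \<bbbD>" if "w \<in> \<bbbD>" for w
    using f that by (auto simp: holomorphic_on_bidisk_def)
  have fw: "(\<lambda>w. f (z, w)) holomorphic_on \<bbbD>" if "z \<in> \<bbbD>" for z
    using f that by (auto simp: holomorphic_on_bidisk_def)
  define g where "g = (\<lambda>h w. (f (of_real h, w) - (\<Sum>k<m. A k w * of_real h ^ k)) / of_real h ^ m)"
  have hol: "A m holomorphic_on ball 0 R" if R: "R \<in> {0<..<1}" for R
  proof -
    have sub: "cball 0 R \<subseteq> \<bbbD>" using R by auto
    have "continuous_on (cball 0 R \<times> cball 0 R) f"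
      using f sub by (auto simp: holomorphic_on_bidisk_def intro: continuous_on_subset)
    then have "bounded (f ` (cball 0 R \<times> cball 0 R))"
      by (intro compact_imp_bounded compact_continuous_image compact_Times compact_cball)
    then obtain B where B: "0 < B" "\<And>z w. z \<in> cball 0 R \<Longrightarrow> w \<in> cball 0 R \<Longrightarrow> cmod (f (z, w)) \<le> B"
      by (auto simp: bounded_pos)
    have A: "cmod (A k w) \<le> B / R ^ k" if "w \<in> cball 0 R" for k w
      unfolding A_def by (rule taylor_bound) (use that R sub B in \<open>auto intro: fz\<close>)
    \<comment> \<open>After division by \<open>h ^ m\<close> the terms beyond order \<open>m\<close>
      are at most \<open>B / R ^ Suc m * h\<close> times a geometric series of ratio
      \<open>h / R\<close>; h \<le> R / 2 bounds that series by 2.\<close>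
    have est: "cmod (g h w - A m w) \<le> 2 * B / R ^ Suc m * h"
      if h: "0 < h" "h \<le> R / 2" and w: "w \<in> cball 0 R" for h w
    proof -
      have "((\<lambda>k. A k w * of_real h ^ k) has_sum f (of_real h, w)) UNIV"
        unfolding A_def by (rule has_sum_taylor) (use h R w in \<open>auto intro: fz\<close>)
      from has_sum_imp_sums[OF this] have "(\<lambda>k. A k w * of_real h ^ k) sums f (of_real h, w)" .
      then have "(\<lambda>j. A (j + Suc m) w * of_real h ^ (j + Suc m)) sums
          (f (of_real h, w) - (\<Sum>k<Suc m. A k w * of_real h ^ k))"
        by (rule sums_split_initial_segment)
      moreover have "(\<lambda>j. B * (h / R) ^ Suc m * (h / R) ^ j) sums (B * (h / R) ^ Suc m * (1 / (1 - h / R)))"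
        by (intro sums_mult geometric_sums) (use h R in auto)
      moreover have "cmod (A (j + Suc m) w * of_real h ^ (j + Suc m)) \<le> B * (h / R) ^ Suc m * (h / R) ^ j" for j
      proof -
        have "cmod (A (j + Suc m) w * of_real h ^ (j + Suc m)) \<le> B / R ^ (j + Suc m) * h ^ (j + Suc m)"
          unfolding norm_mult norm_power norm_of_real abs_of_pos[OF h(1)]
          using h(1) by (intro mult_right_mono A w) auto
        also have "\<dots> = B * (h / R) ^ (j + Suc m)" by (simp only: power_divide) simp
        finally show ?thesis by (simp only: power_add mult_ac)
      qed
      ultimately have "cmod (f (of_real h, w) - (\<Sum>k<Suc m. A k w * of_real h ^ k)) \<le>
          B * (h / R) ^ Suc m * (1 / (1 - h / R))"
        by (rule norm_sums_le)
      also have "\<dots> \<le> B * (h / R) ^ Suc m * 2"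
      proof (rule mult_left_mono)
        have "h / R \<le> 1 / 2" using h R by (simp add: pos_divide_le_eq)
        moreover have "1 / (1 - q) \<le> 2" if "q \<le> 1 / 2" for q :: real
          using that by (simp add: pos_divide_le_eq)
        ultimately show "1 / (1 - h / R) \<le> 2" by blast
      qed (use h R B in auto)
      finally have le: "cmod (f (of_real h, w) - (\<Sum>k<Suc m. A k w * of_real h ^ k)) \<le> B * (h / R) ^ Suc m * 2" .
      have "g h w - A m w = (f (of_real h, w) - (\<Sum>k<Suc m. A k w * of_real h ^ k)) / of_real h ^ m"
        using h by (simp add: g_def diff_divide_distrib add_divide_distrib)
      then have "cmod (g h w - A m w) = cmod (f (of_real h, w) - (\<Sum>k<Suc m. A k w * of_real h ^ k)) / h ^ m"
        using h by (simp add: norm_divide norm_power)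
      also have "\<dots> \<le> (B * (h / R) ^ Suc m * 2) / h ^ m"
        using h by (intro divide_right_mono le) auto
      also have "\<dots> = 2 * B / R ^ Suc m * h"
        using h R by (simp add: power_divide)
      finally show ?thesis .
    qed
    have "uniform_limit (cball 0 R) g (A m) (at_right 0)"
    proof (rule uniform_limitI)
      fix e :: real assume e: "e > 0"
      \<comment> \<open>The first entry makes \<open>est\<close> applicable, the second makes its
        right-hand side smaller than \<open>e\<close>.\<close>
      define d where "d = min (R / 2) (e / (2 * B / R ^ Suc m))"
      have "0 < d" using e R B by (auto simp: d_def)
      moreover have "\<forall>w\<in>cball 0 R. dist (g h w) (A m w) < e" if "0 < h" "h < d" for h
      proof
        fix w :: complex assume w: "w \<in> cball 0 R"
        have "h < e / (2 * B / R ^ Suc m)" using that by (simp add: d_def)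
        moreover have "0 < 2 * B / R ^ Suc m" using B R by auto
        ultimately have "2 * B / R ^ Suc m * h < e"
          by (simp only: pos_less_divide_eq mult.commute)
        then show "dist (g h w) (A m w) < e"
          using est[of h w] that w by (simp add: dist_norm d_def)
      qed
      ultimately show "\<forall>\<^sub>F h in at_right 0. \<forall>w\<in>cball 0 R. dist (g h w) (A m w) < e"
        by (intro eventually_at_rightI[of 0 d]) auto
    qed
    moreover have "\<forall>\<^sub>F h in at_right 0. continuous_on (cball 0 R) (g h) \<and> g h holomorphic_on ball 0 R"
    proof (rule eventually_at_rightI[of 0 1])
      fix h :: real assume h: "h \<in> {0<..<1}"
      \<comment> \<open>The induction enters here: the subtracted coefficients of order below
        \<open>m\<close> are holomorphic in w.\<close>
      have "g h holomorphic_on \<bbbD>"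
        unfolding g_def A_def
        by (intro holomorphic_on_divide holomorphic_on_diff holomorphic_on_sum holomorphic_on_mult
            holomorphic_on_const fw less.IH) (use h in auto)
      then show "continuous_on (cball 0 R) (g h) \<and> g h holomorphic_on ball 0 R"
        using sub by (intro conjI holomorphic_on_imp_continuous_on; elim holomorphic_on_subset) auto
    qed auto
    ultimately show ?thesis
      by (elim holomorphic_uniform_limit[rotated]) auto
  qed
  have "A m holomorphic_on (\<Union>R\<in>{0<..<1}. ball 0 R)"
    using hol by (intro holomorphic_on_UN_open) auto
  then show ?case unfolding A_def by (simp only: UN_ball_radius_less_1)
qed

section \<open>The Hardy space of the disk\<close>

lemma geometric_summable_on:
  fixes r :: real
  assumes "0 \<le> r" "r < 1"
  shows "(\<lambda>n::nat. r ^ n) summable_on UNIV"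
  using assms by (intro norm_summable_imp_summable_on) (auto intro!: summable_geometric simp: norm_power)

lemma geometric2_summable_on:
  fixes r :: real
  assumes "0 \<le> r" "r < 1"
  shows "(\<lambda>k::nat \<times> nat. r ^ (fst k + snd k)) summable_on UNIV"
proof -
  have "(\<lambda>k. complex_of_real r ^ fst k * complex_of_real r ^ snd k) summable_on UNIV"
    using summable_on_product[of "\<lambda>n. complex_of_real r ^ n" "\<lambda>n. complex_of_real r ^ n"]
      geometric_summable_on[OF assms] assms
    by (simp add: summable_on_iff_abs_summable_on_complex norm_power)
  then show ?thesis
    using assms by (simp add: summable_on_iff_abs_summable_on_complex norm_mult norm_power power_add)
qed

interpretation H1: monomial_space "\<bbbD>" "sphere 0 1" "\<lambda>n z. z ^ n" "\<lambda>n. n"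
  "\<lambda>r z. of_real r * z" circle_integral "{f. f holomorphic_on \<bbbD>}"
proof
  show "(\<lambda>i. r ^ i) summable_on UNIV" if "0 \<le> r" "r < 1" for r :: real
    using that by (rule geometric_summable_on)
  show "\<exists>r. 0 \<le> r \<and> r < 1 \<and> (\<forall>i. cmod (x ^ i) \<le> r ^ i)" if "x \<in> \<bbbD>" for x
    using that by (intro exI[of _ "cmod x"]) (auto simp: norm_power)
  show "circle_integral F = circle_integral G" if "\<And>x. x \<in> sphere 0 1 \<Longrightarrow> F x = G x" for F G
    using that by (rule circle_integral_cong)
  show "circle_integral (\<lambda>x. \<Sum>\<^sub>\<infinity>k. c k * (x ^ fst k * cnj (x ^ snd k))) =
      (\<Sum>\<^sub>\<infinity>k. if fst k = snd k then c k else 0)" if "c summable_on UNIV" for c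
    by (subst circle_integral_infsum[OF that])
      (auto intro!: continuous_intros infsum_cong simp: norm_mult norm_power circle_integral_monomial
        simp del: complex_cnj_power)
next
  fix f assume "f \<in> {f. f holomorphic_on \<bbbD>}"
  then have f: "f holomorphic_on \<bbbD>" by simp
  have "(\<lambda>i. taylor f i * of_real (r ^ i)) summable_on UNIV" if "0 \<le> r" "r < 1" for r :: real
    using has_sum_imp_summable[OF has_sum_taylor[OF f, of "of_real r"]] that by simp
  moreover have "f z = (\<Sum>\<^sub>\<infinity>i. taylor f i * z ^ i)" if "z \<in> \<bbbD>" for z
    using has_sum_taylor[OF f that] by (simp add: infsumI)
  ultimately show "\<exists>a. (\<forall>r::real. 0 \<le> r \<and> r < 1 \<longrightarrow>
      (\<lambda>i. a i * of_real (r ^ i)) summable_on UNIV) \<and> (\<forall>x\<in>\<bbbD>. f x = (\<Sum>\<^sub>\<infinity>i. a i * x ^ i))"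
    by blast
next
  fix a :: "nat \<Rightarrow> complex"
  assume a: "\<And>r::real. 0 \<le> r \<Longrightarrow> r < 1 \<Longrightarrow> (\<lambda>i. a i * of_real (r ^ i)) summable_on UNIV"
  have "(\<lambda>x. \<Sum>\<^sub>\<infinity>i. a i * x ^ i) holomorphic_on \<bbbD>"
  proof (rule holomorphic_on_infsum)
    fix R :: real assume R: "0 < R" "R < 1"
    have "(\<lambda>i. cmod (a i) * R ^ i) summable_on UNIV"
      using a[of R] R by (simp add: summable_on_iff_abs_summable_on_complex norm_mult norm_power)
    then show "\<exists>B. B summable_on UNIV \<and> (\<forall>i. \<forall>z\<in>cball 0 R. cmod (a i * z ^ i) \<le> B i)"
      by (intro exI[of _ "\<lambda>i. cmod (a i) * R ^ i"])
        (auto simp: norm_mult norm_power intro!: mult_left_mono power_mono)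
  qed (intro holomorphic_intros)
  then show "(\<lambda>x. if x \<in> \<bbbD> then \<Sum>\<^sub>\<infinity>i. a i * x ^ i else 0) \<in> {f. f holomorphic_on \<bbbD>}"
    by (auto elim: holomorphic_transform)
qed (auto simp: norm_mult norm_power power_mult_distrib)

lemma hardy_eq_hspace: "hardy = H1.hspace"
  by (auto simp: hardy_def H1.hspace_def)

lemma hardy_inner_eq_hinner: "hardy_inner = H1.hinner"
  by (simp add: hardy_inner_def H1.hinner_def fun_eq_iff)

section \<open>Double power series and the Hardy space of the bidisk\<close>

lemma circle_integral2_infsum:
  fixes c :: "(nat \<times> nat) \<times> nat \<times> nat \<Rightarrow> complex"
  assumes c: "c summable_on UNIV"
  shows "circle_integral (\<lambda>z. circle_integral (\<lambda>w. \<Sum>\<^sub>\<infinity>k. c k *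
      (z ^ fst (fst k) * w ^ snd (fst k) * cnj (z ^ fst (snd k) * w ^ snd (snd k))))) =
    (\<Sum>\<^sub>\<infinity>k. if fst k = snd k then c k else 0)"
proof -
  \<comment> \<open>\<open>k\<close> is a pair of bi-indices; \<open>e\<close> collects the factors
    in z and \<open>e'\<close> those in w. Integrating over w first leaves the indicator
    \<open>\<delta>\<close> of equal w-exponents, and integrating over z then equates the
    z-exponents.\<close>
  define e :: "(nat \<times> nat) \<times> nat \<times> nat \<Rightarrow> complex \<Rightarrow> complex" where "e = (\<lambda>k z. z ^ fst (fst k) * cnj (z ^ fst (snd k)))"
  define e' :: "(nat \<times> nat) \<times> nat \<times> nat \<Rightarrow> complex \<Rightarrow> complex" where "e' = (\<lambda>k z. z ^ snd (fst k) * cnj (z ^ snd (snd k)))"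
  define \<delta> :: "(nat \<times> nat) \<times> nat \<times> nat \<Rightarrow> complex" where "\<delta> = (\<lambda>k. if snd (fst k) = snd (snd k) then 1 else 0)"
  have e: "continuous_on (sphere 0 1) (e k)" "continuous_on (sphere 0 1) (e' k)"
    "\<And>z. z \<in> sphere 0 1 \<Longrightarrow> cmod (e k z) = 1" "\<And>z. z \<in> sphere 0 1 \<Longrightarrow> cmod (e' k z) = 1" for k
    by (auto simp: e_def e'_def norm_mult norm_power intro!: continuous_intros)
  have ci: "circle_integral (e k) = (if fst (fst k) = fst (snd k) then 1 else 0)"
    "circle_integral (e' k) = \<delta> k" for k
    by (simp_all only: e_def e'_def \<delta>_def circle_integral_monomial)
  have bd: "(\<lambda>k. c k * d k) summable_on UNIV" if "\<And>k. cmod (d k) \<le> 1" for d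
  proof -
    have "(\<lambda>k. norm (c k)) summable_on UNIV" using c by (simp add: summable_on_iff_abs_summable_on_complex)
    then have "(\<lambda>k. norm (c k * d k)) summable_on UNIV"
      by (rule Infinite_Sum.abs_summable_on_comparison_test')
        (auto simp: norm_mult intro!: mult_left_le that)
    then show ?thesis by (rule abs_summable_summable)
  qed
  have "circle_integral (\<lambda>z. circle_integral (\<lambda>w. \<Sum>\<^sub>\<infinity>k. c k *
      (z ^ fst (fst k) * w ^ snd (fst k) * cnj (z ^ fst (snd k) * w ^ snd (snd k))))) =
      circle_integral (\<lambda>z. \<Sum>\<^sub>\<infinity>k. c k * \<delta> k * e k z)"
  proof (rule circle_integral_cong)
    fix z :: complex assume z: "z \<in> sphere 0 1"
    have "circle_integral (\<lambda>w. \<Sum>\<^sub>\<infinity>k. c k * e k z * e' k w) = (\<Sum>\<^sub>\<infinity>k. c k * e k z * circle_integral (e' k))"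
      by (rule circle_integral_infsum) (use e z in \<open>auto intro!: bd\<close>)
    then show "circle_integral (\<lambda>w. \<Sum>\<^sub>\<infinity>k. c k *
        (z ^ fst (fst k) * w ^ snd (fst k) * cnj (z ^ fst (snd k) * w ^ snd (snd k)))) =
        (\<Sum>\<^sub>\<infinity>k. c k * \<delta> k * e k z)"
      unfolding ci by (simp add: e_def e'_def mult_ac)
  qed
  also have "\<dots> = (\<Sum>\<^sub>\<infinity>k. c k * \<delta> k * circle_integral (e k))"
    by (rule circle_integral_infsum) (use e in \<open>auto intro!: bd simp: \<delta>_def\<close>)
  also have "\<dots> = (\<Sum>\<^sub>\<infinity>k. if fst k = snd k then c k else 0)"
    unfolding ci by (rule infsum_cong) (auto simp: \<delta>_def prod_eq_iff)
  finally show ?thesis .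
qed

text \<open>The coefficient of \<open>z ^ fst k * w ^ snd k\<close>, taken first in z and then in w.
  This order fits \<open>holomorphic_on_taylor\<close>, which makes the inner coefficient
  holomorphic in w.\<close>

definition taylor2 :: "(complex \<times> complex \<Rightarrow> complex) \<Rightarrow> nat \<times> nat \<Rightarrow> complex" where
  "taylor2 f k = taylor (\<lambda>w. taylor (\<lambda>z. f (z, w)) (fst k)) (snd k)"

text \<open>Cauchy's estimate twice: compactness bounds \<open>f\<close> on the closed bidisk of
  radius \<open>R\<close>, the first estimate is uniform in w, and its result is the bound that
  enters the second.\<close>

lemma taylor2_bound:
  assumes f: "holomorphic_on_bidisk f" and R: "0 < R" "R < 1"
  obtains B where "0 < B" "\<And>k. cmod (taylor2 f k) \<le> B / R ^ (fst k + snd k)"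
proof -
  have sub: "cball 0 R \<subseteq> \<bbbD>" using R by auto
  have "continuous_on (cball 0 R \<times> cball 0 R) f"
    using f sub by (auto simp: holomorphic_on_bidisk_def intro: continuous_on_subset)
  then have "bounded (f ` (cball 0 R \<times> cball 0 R))"
    by (intro compact_imp_bounded compact_continuous_image compact_Times compact_cball)
  then obtain B where B: "0 < B" "\<And>z w. z \<in> cball 0 R \<Longrightarrow> w \<in> cball 0 R \<Longrightarrow> cmod (f (z, w)) \<le> B"
    by (auto simp: bounded_pos)
  have "cmod (taylor (\<lambda>z. f (z, w)) m) \<le> B / R ^ m" if "w \<in> cball 0 R" for w m
  proof (rule taylor_bound)
    show "(\<lambda>z. f (z, w)) holomorphic_on \<bbbD>"
      using f that sub by (auto simp: holomorphic_on_bidisk_def simp del: mem_cball mem_ball)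
  qed (use that R B in auto)
  then have "cmod (taylor2 f k) \<le> (B / R ^ fst k) / R ^ snd k" for k
    unfolding taylor2_def by (rule taylor_bound[OF holomorphic_on_taylor[OF f] R])
  then show thesis using that B(1) by (simp add: power_add)
qed

lemma taylor2_summable:
  fixes r :: real
  assumes f: "holomorphic_on_bidisk f" and r: "0 \<le> r" "r < 1"
  shows "(\<lambda>k. taylor2 f k * of_real (r ^ (fst k + snd k))) summable_on UNIV"
proof -
  \<comment> \<open>A radius strictly between \<open>r\<close> and 1: the bound on the coefficients
    at \<open>R\<close> leaves a geometric majorant of ratio \<open>r / R\<close>, which is below
    1.\<close>
  define R where "R = (r + 1) / 2"
  have R: "0 < R" "R < 1" "r / R < 1" using r by (auto simp: R_def)
  obtain B where B: "0 < B" "\<And>k. cmod (taylor2 f k) \<le> B / R ^ (fst k + snd k)"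
    using taylor2_bound[OF f R(1,2)] by blast
  have "(\<lambda>k::nat\<times>nat. B * (r / R) ^ (fst k + snd k)) summable_on UNIV"
    using R r by (intro summable_on_cmult_right geometric2_summable_on) auto
  then have "(\<lambda>k. norm (taylor2 f k * of_real (r ^ (fst k + snd k)))) summable_on UNIV"
  proof (rule Infinite_Sum.abs_summable_on_comparison_test')
    fix k
    have "norm (taylor2 f k * of_real (r ^ (fst k + snd k))) = cmod (taylor2 f k) * r ^ (fst k + snd k)"
      using r by (simp add: norm_mult norm_power)
    also have "\<dots> \<le> B / R ^ (fst k + snd k) * r ^ (fst k + snd k)"
      using r by (intro mult_right_mono B) auto
    also have "\<dots> = B * (r / R) ^ (fst k + snd k)" by (simp only: power_divide) simp
    finally show "norm (taylor2 f k * of_real (r ^ (fst k + snd k))) \<le> B * (r / R) ^ (fst k + snd k)" .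
  qed
  then show ?thesis by (rule abs_summable_summable)
qed

text \<open>Absolute convergence allows summing over the w-exponents first; this restores the Taylor
  coefficients in z of the slice at \<open>w\<close>, and summing over the z-exponents restores
  \<open>f\<close>.\<close>

lemma infsum_taylor2:
  assumes f: "holomorphic_on_bidisk f" and z: "z \<in> \<bbbD>" and w: "w \<in> \<bbbD>"
  shows "f (z, w) = (\<Sum>\<^sub>\<infinity>k. taylor2 f k * (z ^ fst k * w ^ snd k))"
proof -
  define r where "r = max (cmod z) (cmod w)"
  have r: "0 \<le> r" "r < 1" "cmod z \<le> r" "cmod w \<le> r"
    using z w by (auto simp: r_def le_max_iff_disj)
  have "(\<lambda>k. cmod (taylor2 f k * of_real (r ^ (fst k + snd k)))) summable_on UNIV"
    using taylor2_summable[OF f r(1,2)] by (simp only: summable_on_iff_abs_summable_on_complex)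
  then have "(\<lambda>k. cmod (taylor2 f k * (z ^ fst k * w ^ snd k))) summable_on UNIV"
    by (rule Infinite_Sum.abs_summable_on_comparison_test')
      (use r in \<open>auto simp: norm_mult norm_power power_add intro!: mult_mono power_mono\<close>)
  then have s: "(\<lambda>k. taylor2 f k * (z ^ fst k * w ^ snd k)) summable_on UNIV"
    by (rule abs_summable_summable)
  have "(\<Sum>\<^sub>\<infinity>k. taylor2 f k * (z ^ fst k * w ^ snd k)) =
      (\<Sum>\<^sub>\<infinity>m. \<Sum>\<^sub>\<infinity>n. taylor2 f (m, n) * (z ^ m * w ^ n))"
    using infsum_Sigma_banach[of _ UNIV "\<lambda>_. UNIV"] s by fastforce
  also have "\<dots> = (\<Sum>\<^sub>\<infinity>m. taylor (\<lambda>z. f (z, w)) m * z ^ m)"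
  proof (rule infsum_cong)
    fix m
    have "(\<Sum>\<^sub>\<infinity>n. taylor2 f (m, n) * (z ^ m * w ^ n)) =
        z ^ m * (\<Sum>\<^sub>\<infinity>n. taylor (\<lambda>w. taylor (\<lambda>z. f (z, w)) m) n * w ^ n)"
      by (simp add: taylor2_def mult.left_commute infsum_cmult_right')
    also have "\<dots> = z ^ m * taylor (\<lambda>z. f (z, w)) m"
      using has_sum_taylor[OF holomorphic_on_taylor[OF f] w] by (simp add: infsumI)
    finally show "(\<Sum>\<^sub>\<infinity>n. taylor2 f (m, n) * (z ^ m * w ^ n)) = taylor (\<lambda>z. f (z, w)) m * z ^ m"
      by (simp add: mult.commute)
  qed
  also have "\<dots> = f (z, w)"
    using has_sum_taylor[of "\<lambda>z. f (z, w)" z] f z w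
    by (intro infsumI) (auto simp: holomorphic_on_bidisk_def)
  finally show ?thesis ..
qed

lemma holomorphic_on_bidisk_infsum:
  fixes a :: "nat \<times> nat \<Rightarrow> complex"
  assumes a: "\<And>r::real. 0 \<le> r \<Longrightarrow> r < 1 \<Longrightarrow> (\<lambda>k. a k * of_real (r ^ (fst k + snd k))) summable_on UNIV"
  shows "holomorphic_on_bidisk (\<lambda>p. if p \<in> \<bbbD> \<times> \<bbbD> then \<Sum>\<^sub>\<infinity>k. a k * (fst p ^ fst k * snd p ^ snd k) else 0)"
proof -
  have le: "cmod (a k * (z ^ fst k * w ^ snd k)) \<le> cmod (a k) * R ^ (fst k + snd k)"
    if "cmod z \<le> R" "cmod w \<le> R" for z w R k
  proof -
    have "0 \<le> R" using that(1) norm_ge_zero[of z] by linarith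
    then show ?thesis using that
      by (auto simp: norm_mult norm_power power_add intro!: mult_mono power_mono)
  qed
  have s: "(\<lambda>k. cmod (a k) * R ^ (fst k + snd k)) summable_on UNIV" if "0 \<le> R" "R < 1" for R
    using a[OF that] that by (simp add: summable_on_iff_abs_summable_on_complex norm_mult norm_power)
  have cont: "continuous_on (\<bbbD> \<times> \<bbbD>) (\<lambda>p. \<Sum>\<^sub>\<infinity>k. a k * (fst p ^ fst k * snd p ^ snd k))"
  proof (rule continuous_on_bidisk_infsum)
    fix R :: real assume R: "0 < R" "R < 1"
    show "\<exists>B. B summable_on UNIV \<and>
        (\<forall>k. \<forall>p\<in>cball 0 R \<times> cball 0 R. cmod (a k * (fst p ^ fst k * snd p ^ snd k)) \<le> B k)"
      by (intro exI[of _ "\<lambda>k. cmod (a k) * R ^ (fst k + snd k)"] conjI s allI ballI le) (use R in auto)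
  qed (intro continuous_intros)
  have hol: "(\<lambda>z. \<Sum>\<^sub>\<infinity>k. a k * (z ^ fst k * w ^ snd k)) holomorphic_on \<bbbD>"
    "(\<lambda>z. \<Sum>\<^sub>\<infinity>k. a k * (w ^ fst k * z ^ snd k)) holomorphic_on \<bbbD>" if "w \<in> \<bbbD>" for w
  proof -
    have bd: "\<exists>B. B summable_on UNIV \<and> (\<forall>i. \<forall>z\<in>cball 0 R. cmod (a i * (z ^ fst i * w ^ snd i)) \<le> B i) \<and>
        (\<forall>i. \<forall>z\<in>cball 0 R. cmod (a i * (w ^ fst i * z ^ snd i)) \<le> B i)" if R: "0 < R" "R < 1" for R
    proof -
      \<comment> \<open>One radius for both slots: it dominates the fixed coordinate
        \<open>w\<close> as well as the moving one, so the same majorant serves in either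
        variable.\<close>
      define r where "r = max R (cmod w)"
      have r: "0 \<le> r" "r < 1" "cmod w \<le> r" "\<And>z. z \<in> cball 0 R \<Longrightarrow> cmod z \<le> r"
        using R \<open>w \<in> \<bbbD>\<close> by (auto simp: r_def)
      show ?thesis
        by (intro exI[of _ "\<lambda>k. cmod (a k) * r ^ (fst k + snd k)"] conjI s allI ballI le r) auto
    qed
    show "(\<lambda>z. \<Sum>\<^sub>\<infinity>k. a k * (z ^ fst k * w ^ snd k)) holomorphic_on \<bbbD>"
    proof (rule holomorphic_on_infsum)
      fix R :: real assume "0 < R" "R < 1"
      from bd[OF this] show "\<exists>B. B summable_on UNIV \<and> (\<forall>k. \<forall>z\<in>cball 0 R. cmod (a k * (z ^ fst k * w ^ snd k)) \<le> B k)"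
        by blast
    qed (intro holomorphic_intros)
    show "(\<lambda>z. \<Sum>\<^sub>\<infinity>k. a k * (w ^ fst k * z ^ snd k)) holomorphic_on \<bbbD>"
    proof (rule holomorphic_on_infsum)
      fix R :: real assume "0 < R" "R < 1"
      from bd[OF this] show "\<exists>B. B summable_on UNIV \<and> (\<forall>k. \<forall>z\<in>cball 0 R. cmod (a k * (w ^ fst k * z ^ snd k)) \<le> B k)"
        by blast
    qed (intro holomorphic_intros)
  qed
  show ?thesis
    unfolding holomorphic_on_bidisk_def
  proof (intro conjI ballI)
    show "continuous_on (\<bbbD> \<times> \<bbbD>)
        (\<lambda>p. if p \<in> \<bbbD> \<times> \<bbbD> then \<Sum>\<^sub>\<infinity>k. a k * (fst p ^ fst k * snd p ^ snd k) else 0)"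
      by (rule continuous_on_eq[OF cont]) simp
  next
    fix w :: complex assume "w \<in> \<bbbD>"
    then show "(\<lambda>z. if (z, w) \<in> \<bbbD> \<times> \<bbbD>
        then \<Sum>\<^sub>\<infinity>k. a k * (fst (z, w) ^ fst k * snd (z, w) ^ snd k) else 0) holomorphic_on \<bbbD>"
      by (intro holomorphic_transform[OF hol(1)]) auto
  next
    fix w :: complex assume "w \<in> \<bbbD>"
    then show "(\<lambda>z. if (w, z) \<in> \<bbbD> \<times> \<bbbD>
        then \<Sum>\<^sub>\<infinity>k. a k * (fst (w, z) ^ fst k * snd (w, z) ^ snd k) else 0) holomorphic_on \<bbbD>"
      by (intro holomorphic_transform[OF hol(2)]) auto
  qed
qed

interpretation H2: monomial_space "\<bbbD> \<times> \<bbbD>" "sphere 0 1 \<times> sphere 0 1"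
  "\<lambda>k p. fst p ^ fst k * snd p ^ snd k" "\<lambda>k. fst k + snd k"
  "\<lambda>r p. (of_real r * fst p, of_real r * snd p)"
  "\<lambda>F. circle_integral (\<lambda>z. circle_integral (\<lambda>w. F (z, w)))" "Collect holomorphic_on_bidisk"
proof
  show "(\<lambda>i::nat\<times>nat. r ^ (fst i + snd i)) summable_on UNIV" if "0 \<le> r" "r < 1" for r :: real
    using that by (rule geometric2_summable_on)
  show "\<exists>r. 0 \<le> r \<and> r < 1 \<and> (\<forall>i. cmod (fst p ^ fst i * snd p ^ snd i) \<le> r ^ (fst i + snd i))"
    if "p \<in> \<bbbD> \<times> \<bbbD>" for p
  proof -
    define r where "r = max (cmod (fst p)) (cmod (snd p))"
    have "0 \<le> r" "r < 1" "cmod (fst p) \<le> r" "cmod (snd p) \<le> r"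
      using that by (auto simp: r_def le_max_iff_disj)
    then show ?thesis
      by (intro exI[of _ r]) (auto simp: norm_mult norm_power power_add intro!: mult_mono power_mono)
  qed
  show "circle_integral (\<lambda>z. circle_integral (\<lambda>w. F (z, w))) = circle_integral (\<lambda>z. circle_integral (\<lambda>w. G (z, w)))"
    if "\<And>x. x \<in> sphere 0 1 \<times> sphere 0 1 \<Longrightarrow> F x = G x" for F G
    by (intro circle_integral_cong that) auto
  show "circle_integral (\<lambda>z. circle_integral (\<lambda>w. \<Sum>\<^sub>\<infinity>k. c k *
        (fst (z, w) ^ fst (fst k) * snd (z, w) ^ snd (fst k) *
          cnj (fst (z, w) ^ fst (snd k) * snd (z, w) ^ snd (snd k))))) =
      (\<Sum>\<^sub>\<infinity>k. if fst k = snd k then c k else 0)" if "c summable_on UNIV" for c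
    using circle_integral2_infsum[OF that] by simp
next
  fix f assume "f \<in> Collect holomorphic_on_bidisk"
  then have f: "holomorphic_on_bidisk f" by simp
  show "\<exists>a. (\<forall>r::real. 0 \<le> r \<and> r < 1 \<longrightarrow> (\<lambda>k. a k * of_real (r ^ (fst k + snd k))) summable_on UNIV) \<and>
      (\<forall>x\<in>\<bbbD> \<times> \<bbbD>. f x = (\<Sum>\<^sub>\<infinity>k. a k * (fst x ^ fst k * snd x ^ snd k)))"
    using taylor2_summable[OF f] infsum_taylor2[OF f] by (intro exI[of _ "taylor2 f"]) auto
next
  fix a :: "nat \<times> nat \<Rightarrow> complex"
  assume "\<And>r::real. 0 \<le> r \<Longrightarrow> r < 1 \<Longrightarrow> (\<lambda>k. a k * of_real (r ^ (fst k + snd k))) summable_on UNIV"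
  then show "(\<lambda>p. if p \<in> \<bbbD> \<times> \<bbbD> then \<Sum>\<^sub>\<infinity>k. a k * (fst p ^ fst k * snd p ^ snd k) else 0)
      \<in> Collect holomorphic_on_bidisk"
    using holomorphic_on_bidisk_infsum[of a] by simp
qed (auto simp: norm_mult norm_power power_mult_distrib power_add mult_ac)

lemma hardy2_eq_hspace: "hardy2 = H2.hspace"
  by (auto simp: hardy2_def H2.hspace_def)

lemma hardy2_inner_eq_hinner: "hardy2_inner = H2.hinner"
  by (simp add: hardy2_inner_def H2.hinner_def fun_eq_iff)

lemma shift_adj_series:
  assumes "ell2 a"
  shows "shift_adj (H1.series a) = H1.series (a \<circ> Suc)"
  using H1.adjoint_on_mult[of Suc "\<lambda>z. z" a] assms
  by (simp add: shift_adj_def hardy_eq_hspace hardy_inner_eq_hinner shift_def[abs_def])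

lemma shift_z_adj_series:
  assumes "ell2 a"
  shows "shift_z_adj (H2.series a) = H2.series (a \<circ> map_prod Suc id)"
proof -
  have "shift_z = (\<lambda>f p. fst p * f p)" by (simp add: shift_z_def fun_eq_iff)
  then show ?thesis
    using H2.adjoint_on_mult[of "map_prod Suc id" fst a] assms
    by (simp add: shift_z_adj_def hardy2_eq_hspace hardy2_inner_eq_hinner prod.inj_map mult.assoc)
qed

subsection \<open>The operator \<open>P_g\<close>\<close>

text \<open>Meant for the family \<open>z ^ m * cnj (b n)\<close>: multiplied by a square summable
  \<open>a\<close> it is absolutely summable over all (m, n), which permits the exchange of sums in
  \<open>P_g_series\<close>.\<close>

lemma ell2_product:
  assumes "ell2 a" "ell2 b"
  shows "ell2 (\<lambda>k. a (fst k) * b (snd k))"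
proof -
  have "(\<lambda>i. complex_of_real ((cmod (a i))\<^sup>2)) summable_on UNIV" "(\<lambda>i. complex_of_real ((cmod (b i))\<^sup>2)) summable_on UNIV"
    using assms by (simp_all add: ell2_def summable_on_iff_abs_summable_on_complex norm_power)
  from summable_on_product[OF this] show ?thesis
    by (simp add: ell2_def summable_on_iff_abs_summable_on_complex norm_mult norm_power power_mult_distrib)
qed

lemma
  fixes a :: "'i \<times> 'j \<Rightarrow> complex"
  assumes a: "ell2 a"
  shows ell2_section: "ell2 (\<lambda>j. a (i, j))"
    and ell2_norm_section_summable: "(\<lambda>i. \<Sum>\<^sub>\<infinity>j. (cmod (a (i, j)))\<^sup>2) summable_on UNIV"
proof -
  show s: "ell2 (\<lambda>j. a (i, j))" for i
    using ell2_comp_inj[of "Pair i" a] a by (simp add: o_def inj_on_def)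
  show "(\<lambda>i. \<Sum>\<^sub>\<infinity>j. (cmod (a (i, j)))\<^sup>2) summable_on UNIV"
    using a s by (intro summable_on_SigmaD[where f = "\<lambda>k. (cmod (a k))\<^sup>2"]) (auto simp: ell2_def)
qed

text \<open>Cauchy-Schwarz in each row. It serves in two directions: summing out the w-index gives
  \<open>P_g\<close>, and summing out the z-index against powers of z gives the coefficients of a
  slice.\<close>

lemma ell2_contract:
  fixes a :: "'i \<times> 'j \<Rightarrow> complex"
  assumes "ell2 a" "ell2 b"
  shows "ell2 (\<lambda>i. \<Sum>\<^sub>\<infinity>j. a (i, j) * b j)"
proof -
  have "(\<lambda>i. (\<Sum>\<^sub>\<infinity>j. (cmod (a (i, j)))\<^sup>2) * (\<Sum>\<^sub>\<infinity>j. (cmod (b j))\<^sup>2)) summable_on UNIV"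
    by (intro summable_on_cmult_left ell2_norm_section_summable assms)
  then show ?thesis unfolding ell2_def
  proof (rule summable_on_comparison_test)
    fix i
    have "(cmod (\<Sum>\<^sub>\<infinity>j. a (i, j) * b j))\<^sup>2 \<le>
        (sqrt (\<Sum>\<^sub>\<infinity>j. (cmod (a (i, j)))\<^sup>2) * sqrt (\<Sum>\<^sub>\<infinity>j. (cmod (b j))\<^sup>2))\<^sup>2"
      by (intro power_mono ell2_Cauchy_Schwarz ell2_section assms) auto
    also have "\<dots> = (\<Sum>\<^sub>\<infinity>j. (cmod (a (i, j)))\<^sup>2) * (\<Sum>\<^sub>\<infinity>j. (cmod (b j))\<^sup>2)"
      by (simp add: power_mult_distrib infsum_nonneg)
    finally show "(cmod (\<Sum>\<^sub>\<infinity>j. a (i, j) * b j))\<^sup>2 \<le>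
        (\<Sum>\<^sub>\<infinity>j. (cmod (a (i, j)))\<^sup>2) * (\<Sum>\<^sub>\<infinity>j. (cmod (b j))\<^sup>2)" .
  qed simp
qed

text \<open>\<open>P_g\<close> is defined point by point in z. The slice at z has w-coefficients
  \<open>s n\<close>, the sums of \<open>a (m, n) * z ^ m\<close> over m. They are square summable
  for z in the disk, so \<open>H1.hinner_series\<close> evaluates the pairing, and exchanging the
  sums collects the powers of z.\<close>

lemma P_g_series:
  assumes a: "ell2 a" and b: "ell2 b"
  shows "P_g (H1.series b) (H2.series a) = H1.series (\<lambda>m. \<Sum>\<^sub>\<infinity>n. a (m, n) * cnj (b n))"
proof
  fix z
  show "P_g (H1.series b) (H2.series a) z = H1.series (\<lambda>m. \<Sum>\<^sub>\<infinity>n. a (m, n) * cnj (b n)) z"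
  proof (cases "z \<in> \<bbbD>")
    case False
    \<comment> \<open>Off the disk the slice is the zero function, so \<open>P_g\<close> keeps the
      convention of vanishing there.\<close>
    then have "(\<lambda>w. H2.series a (z, w)) = H1.series (\<lambda>_. 0)"
      by (auto simp: H2.series_def H1.series_def)
    then have "P_g (H1.series b) (H2.series a) z = 0"
      using b by (simp add: P_g_def hardy_inner_eq_hinner H1.hinner_series)
    then show ?thesis using False by (simp add: H1.series_def)
  next
    case True
    have zp: "ell2 (\<lambda>m. z ^ m)"
      using True H1.ell2_deg[of "cmod z"] by (simp add: ell2_def norm_power)
    \<comment> \<open>The swap makes the z-index the second one, which is the index that
      \<open>ell2_contract\<close> sums out.\<close>
    define s where "s = (\<lambda>n. \<Sum>\<^sub>\<infinity>m. (a \<circ> prod.swap) (n, m) * z ^ m)"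
    have "ell2 (a \<circ> prod.swap)" using a by (intro ell2_comp_inj) auto
    then have s: "ell2 s" unfolding s_def using zp by (rule ell2_contract)
    have "H2.series a (z, w) = H1.series s w" for w
    proof (cases "w \<in> \<bbbD>")
      case w: True
      have "(\<lambda>k. a k * (z ^ fst k * w ^ snd k)) summable_on UNIV"
        using H2.disc_summable_mon[OF H2.ell2_disc_summable[OF a], of "(z, w)"] True w by simp
      then have sm: "(\<lambda>(m, n). a (m, n) * (z ^ m * w ^ n)) summable_on UNIV \<times> UNIV"
        by (simp add: case_prod_unfold)
      have "(\<Sum>\<^sub>\<infinity>k. a k * (z ^ fst k * w ^ snd k)) = (\<Sum>\<^sub>\<infinity>m. \<Sum>\<^sub>\<infinity>n. a (m, n) * (z ^ m * w ^ n))"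
        using infsum_Sigma'_banach[OF sm] by (simp add: case_prod_unfold)
      also have "\<dots> = (\<Sum>\<^sub>\<infinity>n. \<Sum>\<^sub>\<infinity>m. a (m, n) * (z ^ m * w ^ n))"
        by (rule infsum_swap_banach[OF sm])
      also have "\<dots> = (\<Sum>\<^sub>\<infinity>n. s n * w ^ n)"
        by (simp add: s_def infsum_cmult_left' flip: mult.assoc)
      finally show ?thesis using True w by (simp add: H2.series_def H1.series_def)
    qed (simp add: H2.series_def H1.series_def)
    then have "P_g (H1.series b) (H2.series a) z = (\<Sum>\<^sub>\<infinity>n. s n * cnj (b n))"
      using s b by (simp add: P_g_def hardy_inner_eq_hinner H1.hinner_series)
    also have "\<dots> = (\<Sum>\<^sub>\<infinity>n. \<Sum>\<^sub>\<infinity>m. a (m, n) * (z ^ m * cnj (b n)))"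
      by (simp add: s_def infsum_cmult_left' flip: mult.assoc)
    also have "\<dots> = (\<Sum>\<^sub>\<infinity>m. \<Sum>\<^sub>\<infinity>n. a (m, n) * (z ^ m * cnj (b n)))"
    proof (rule infsum_swap_banach[symmetric])
      show "(\<lambda>(m, n). a (m, n) * (z ^ m * cnj (b n))) summable_on UNIV \<times> UNIV"
        using ell2_mult_summable[OF a ell2_product[OF zp, of "\<lambda>n. cnj (b n)"]] b
        by (simp add: case_prod_unfold)
    qed
    also have "\<dots> = (\<Sum>\<^sub>\<infinity>m. (\<Sum>\<^sub>\<infinity>n. a (m, n) * cnj (b n)) * z ^ m)"
      by (simp only: infsum_cmult_left'[symmetric]) (simp add: mult_ac)
    finally show ?thesis using True by (simp add: H1.series_def)
  qed
qed

theorem theorem2p7: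
  fixes M :: "(complex \<times> complex \<Rightarrow> complex) set"
  assumes "minimal_invariant_subspace hardy2 hardy2_inner shift_z_adj M"
  shows "\<forall>g\<in>hardy. \<exists>V. invariant_subspace hardy hardy_inner shift_adj V \<and>
           (P_g g ` M = {0} \<or> norm_closure hardy hardy_inner (P_g g ` M) = V)"
proof
  fix g assume "g \<in> hardy"
  then obtain b where b: "ell2 b" "g = H1.series b"
    by (auto simp: hardy_eq_hspace elim: H1.hspaceE)
  have M: "M \<subseteq> H2.hspace" "cfun.subspace M" "shift_z_adj ` M \<subseteq> M"
    using assms
    by (auto simp: minimal_invariant_subspace_def invariant_subspace_def closed_subspace_def hardy2_eq_hspace)
  have series_of_M: "\<exists>a. ell2 a \<and> h = H2.series a" if "h \<in> M" for h
    using that M(1) H2.hspaceE[of h] by blast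
  define contract :: "(nat \<times> nat \<Rightarrow> complex) \<Rightarrow> nat \<Rightarrow> complex"
    where "contract = (\<lambda>a m. \<Sum>\<^sub>\<infinity>n. a (m, n) * cnj (b n))"
  have contract: "ell2 (contract a)" if "ell2 a" for a
    unfolding contract_def using that b by (intro ell2_contract) auto
  have P: "P_g g (H2.series a) = H1.series (contract a)" if "ell2 a" for a
    using P_g_series[OF that b(1)] by (simp add: b contract_def)
  have summ: "(\<lambda>n. a (m, n) * cnj (b n)) summable_on UNIV" if "ell2 a" for a :: "nat \<times> nat \<Rightarrow> complex" and m
    using that b by (intro ell2_mult_cnj_summable ell2_section)
  have "P_g g ` M \<subseteq> H1.hspace"
    using series_of_M by (fastforce simp: P contract intro: H1.series_in_hspace)
  \<comment> \<open>Linearity of \<open>P_g g\<close> is read off the coefficients, since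
    \<open>Lim\<close> is additive only once the limits are known to exist.\<close>
  moreover have "cfun.subspace (P_g g ` M)"
  proof (rule cfun.subspaceI)
    have "P_g g 0 = 0"
      using P[of "\<lambda>_. 0"] by (simp add: H2.series_0 H1.series_0 contract_def)
    then show "0 \<in> P_g g ` M" using cfun.subspace_0[OF M(2)] by (metis imageI)
  next
    fix f f' assume "f \<in> P_g g ` M" "f' \<in> P_g g ` M"
    then obtain h h' where h: "h \<in> M" "f = P_g g h" "h' \<in> M" "f' = P_g g h'" by auto
    obtain a a' where a: "ell2 a" "h = H2.series a" "ell2 a'" "h' = H2.series a'"
      using series_of_M[OF h(1)] series_of_M[OF h(3)] by blast
    have "P_g g (h + h') = H1.series (contract (\<lambda>k. a k + a' k))"
      using a by (simp add: P ell2_add flip: H2.series_add)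
    also have "contract (\<lambda>k. a k + a' k) = (\<lambda>m. contract a m + contract a' m)"
      using a by (simp add: contract_def distrib_right infsum_add summ)
    also have "H1.series \<dots> = f + f'"
      using a h by (simp add: H1.series_add contract P)
    finally show "f + f' \<in> P_g g ` M"
      using cfun.subspace_add[OF M(2) h(1,3)] by (metis imageI)
  next
    fix c f assume "f \<in> P_g g ` M"
    then obtain h where h: "h \<in> M" "f = P_g g h" by auto
    obtain a where a: "ell2 a" "h = H2.series a"
      using series_of_M h by blast
    have "P_g g (fscale c h) = H1.series (contract (\<lambda>k. c * a k))"
      using a by (simp add: P ell2_scale flip: H2.series_scale)
    also have "contract (\<lambda>k. c * a k) = (\<lambda>m. c * contract a m)"
      by (simp add: contract_def mult.assoc infsum_cmult_right')
    also have "H1.series \<dots> = fscale c f"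
      using a h by (simp add: H1.series_scale P)
    finally show "fscale c f \<in> P_g g ` M"
      using cfun.subspace_scale[OF M(2) h(1)] by (metis imageI)
  qed
  moreover have "shift_adj ` P_g g ` M \<subseteq> P_g g ` M"
  proof (intro subsetI, elim imageE)
    fix f f' h assume h: "f = shift_adj f'" "f' = P_g g h" "h \<in> M"
    obtain a where a: "ell2 a" "h = H2.series a"
      using series_of_M h by blast
    have "ell2 (a \<circ> map_prod Suc id)" using a by (intro ell2_comp_inj) (auto simp: prod.inj_map)
    then have "P_g g (shift_z_adj h) = H1.series (contract (a \<circ> map_prod Suc id))"
      using a by (simp add: shift_z_adj_series P)
    also have "contract (a \<circ> map_prod Suc id) = contract a \<circ> Suc"
      by (simp add: contract_def fun_eq_iff)
    also have "H1.series \<dots> = f"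
      using h a by (simp add: P shift_adj_series contract)
    finally show "f \<in> P_g g ` M" using M(3) h(3) by blast
  qed
  ultimately have "invariant_subspace hardy hardy_inner shift_adj (norm_closure hardy hardy_inner (P_g g ` M))"
    unfolding hardy_eq_hspace hardy_inner_eq_hinner
    by (rule H1.invariant_subspace_norm_closure[where \<sigma> = Suc]) (auto simp: shift_adj_series)
  then show "\<exists>V. invariant_subspace hardy hardy_inner shift_adj V \<and>
      (P_g g ` M = {0} \<or> norm_closure hardy hardy_inner (P_g g ` M) = V)"
    by blast
qed

end
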